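(* Both of the following hold. (a) (Hoops.) Let $\phi$ be an identity in the language $(0,+,\rightarrow)$ of hoops in the variables $x_1,\ldots,x_n$. Then $\forall x_1,\ldots,x_n\;\phi$ is valid in the class of all hoops if and only if $\phi(x_1,\ldots,x_n)$ holds under any interpretation of $x_1,\ldots,x_n$ in a hoop $\mathbf{H}$ such that: $\mathbf{H}$ can be expressed as an ordinal sum $\mathbf{S}\frown\mathbf{F}$ where $\mathbf{S}$ is subdirectly irreducible and Wajsberg; $\mathbf{H}$ is generated (as a hoop) by (the interpretations of) $x_1,\ldots,x_n$; and $S=\{0\}$ iff $H=\{0\}$. (b) (Bounded hoops.) Let $\phi$ be an identity in the language $(0,1,+,\rightarrow)$ of bounded hoops in the variables $x_1,\ldots,x_n$. Then $\forall x_1,\ldots,x_n\;\phi$ is valid in the class of all bounded hoops if and only if $\phi(x_1,\ldots,x_n)$ holds under any interpretation of $x_1,\ldots,x_n$ in a bounded hoop $\mathbf{H}$ such that: $\mathbf{H}$ can be expressed as an ordinal sum $\mathbf{S}\frown\mathbf{F}$ where $\mathbf{S}$ is subdirectly irreducible and Wajsberg; $\mathbf{H}$ is generated (as a bounded hoop) by (the interpretations of) $x_1,\ldots,x_n$; and $S=\{0\}$ iff $H=\{0\}$.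
   Context: The universe of a structure $\mathbf{P}$ is denoted $P$. The symbol $\rightarrow$ associates to the right and binds less tightly than $+$. A pocrim is a structure $\mathbf{P}=(P;0,+,\rightarrow)$ such that, writing $x\ge y$ for $x\rightarrow y=0$: $(P;0,+)$ is a commutative monoid; $\ge$ is a partial order on $P$ (reflexive, transitive, antisymmetric); $x\ge y$ implies $x+z\ge y+z$; $x\ge 0$ for all $x$; and $x+y\ge z$ iff $x\ge y\rightarrow z$. A hoop is a pocrim satisfying $x+(x\rightarrow y)=y+(y\rightarrow x)$. A pocrim is bounded if it has an element $1$ with $x+1=1$ for all $x$; for bounded hoops, $1$ is taken as a constant of the signature (so it is preserved by homomorphisms and included in the bounded subhoop generated by a set). A hoop is Wajsberg if it satisfies $(x\rightarrow y)\rightarrow y=(y\rightarrow x)\rightarrow x$. An algebra $\mathbf{A}$ is subdirectly irreducible if the intersection of all its congruences other than the identity congruence $\Delta$ is not equal to $\Delta$. The ordinal sum $\mathbf{C}\frown\mathbf{D}$ of pocrims $\mathbf{C}$ and $\mathbf{D}$ is the pocrim with universe the disjoint union $C\sqcup(D\setminus\{0\})$, whose zero is that of $\mathbf{C}$, whose operations extend those of $\mathbf{C}$ and $\mathbf{D}$ (identifying the zero of $\mathbf{D}$ with that of $\mathbf{C}$), and such that for $c\in C$ and $0\ne d\in D$: $c+d=d+c=d$, $c\rightarrow d=d$ and $d\rightarrow c=0$. An identity is an equation $s=t$ between terms of the signature. *)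

theory Defs
  imports "HOL-Algebra.Group"
begin

record 'a pocrim_struct = "'a partial_object" +
  zero :: 'a (\<open>\<zero>\<index>\<close>)
  add :: "'a \<Rightarrow> 'a \<Rightarrow> 'a" (infixl \<open>\<oplus>\<index>\<close> 65)
  imp :: "'a \<Rightarrow> 'a \<Rightarrow> 'a" (infixr \<open>\<rightharpoonup>\<index>\<close> 60)

text \<open>The order is oriented as in the hoop literature: \<open>0\<close> is the least element and
  \<open>x \<ge> y\<close> means \<open>x \<rightharpoonup> y = 0\<close>.\<close>

definition geq :: "('a, 'm) pocrim_struct_scheme \<Rightarrow> 'a \<Rightarrow> 'a \<Rightarrow> bool" (infix \<open>\<succeq>\<index>\<close> 50)
  where "x \<succeq>\<^bsub>P\<^esub> y \<longleftrightarrow> x \<rightharpoonup>\<^bsub>P\<^esub> y = \<zero>\<^bsub>P\<^esub>"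

locale pocrim =
  fixes P :: "('a, 'm) pocrim_struct_scheme" (structure)
  assumes add_comm_monoid: "comm_monoid \<lparr>carrier = carrier P, mult = add P, one = zero P\<rparr>"
    and imp_closed: "\<lbrakk>x \<in> carrier P; y \<in> carrier P\<rbrakk> \<Longrightarrow> x \<rightharpoonup> y \<in> carrier P"
    and geq_partial_order:
      "partial_order_on (carrier P) {(x, y). x \<in> carrier P \<and> y \<in> carrier P \<and> x \<succeq> y}"
    and add_mono:
      "\<lbrakk>x \<in> carrier P; y \<in> carrier P; z \<in> carrier P; x \<succeq> y\<rbrakk> \<Longrightarrow> x \<oplus> z \<succeq> y \<oplus> z"
    and geq_zero: "x \<in> carrier P \<Longrightarrow> x \<succeq> \<zero>"
    and residuation:
      "\<lbrakk>x \<in> carrier P; y \<in> carrier P; z \<in> carrier P\<rbrakk> \<Longrightarrow> x \<oplus> y \<succeq> z \<longleftrightarrow> x \<succeq> (y \<rightharpoonup> z)"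

locale hoop = pocrim P for P :: "('a, 'm) pocrim_struct_scheme" (structure) +
  assumes divisibility:
    "\<lbrakk>x \<in> carrier P; y \<in> carrier P\<rbrakk> \<Longrightarrow> x \<oplus> (x \<rightharpoonup> y) = y \<oplus> (y \<rightharpoonup> x)"

locale wajsberg_hoop = hoop P for P :: "('a, 'm) pocrim_struct_scheme" (structure) +
  assumes wajsberg:
    "\<lbrakk>x \<in> carrier P; y \<in> carrier P\<rbrakk> \<Longrightarrow> (x \<rightharpoonup> y) \<rightharpoonup> y = (y \<rightharpoonup> x) \<rightharpoonup> x"

record 'a bounded_pocrim_struct = "'a pocrim_struct" +
  top_elem :: 'a

locale bounded_hoop = hoop P for P :: "('a, 'm) bounded_pocrim_struct_scheme" (structure) +
  assumes top_closed: "top_elem P \<in> carrier P"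
    and add_top: "x \<in> carrier P \<Longrightarrow> x \<oplus> top_elem P = top_elem P"


text \<open>Congruences with respect to \<open>0, +, \<rightarrow>\<close>.\<close>

definition congruence :: "('a, 'm) pocrim_struct_scheme \<Rightarrow> ('a \<times> 'a) set \<Rightarrow> bool"
  where "congruence A \<theta> \<longleftrightarrow> equiv (carrier A) \<theta> \<and>
    (\<forall>x x' y y'. (x, x') \<in> \<theta> \<longrightarrow> (y, y') \<in> \<theta> \<longrightarrow>
      (x \<oplus>\<^bsub>A\<^esub> y, x' \<oplus>\<^bsub>A\<^esub> y') \<in> \<theta> \<and> (x \<rightharpoonup>\<^bsub>A\<^esub> y, x' \<rightharpoonup>\<^bsub>A\<^esub> y') \<in> \<theta>)"

text \<open>On a one-element algebra the intersection below is over the empty family, hence it is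
  \<open>UNIV\<close>, and the algebra counts as subdirectly irreducible as soon as the underlying type has
  more than one element. Both conventions on one-element algebras occur; this is
  the one under which a condition such as ``\<open>S = {0}\<close> iff \<open>H = {0}\<close>'' has content.\<close>

definition subdirectly_irreducible :: "('a, 'm) pocrim_struct_scheme \<Rightarrow> bool"
  where "subdirectly_irreducible A \<longleftrightarrow>
    \<Inter> {\<theta>. congruence A \<theta> \<and> \<theta> \<noteq> Id_on (carrier A)} \<noteq> Id_on (carrier A)"


text \<open>The embedding of the second summand into the ordinal sum: its zero is identified with that
  of the first.\<close>

definition osum_inr :: "'a pocrim_struct \<Rightarrow> 'b pocrim_struct \<Rightarrow> 'b \<Rightarrow> 'a + 'b"
  where "osum_inr C D d = (if d = \<zero>\<^bsub>D\<^esub> then Inl \<zero>\<^bsub>C\<^esub> else Inr d)"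

definition ordinal_sum ::
    "'a pocrim_struct \<Rightarrow> 'b pocrim_struct \<Rightarrow> ('a + 'b) pocrim_struct" (infixr \<open>\<frown>\<close> 65)
  where "C \<frown> D = \<lparr>
    carrier = carrier C <+> (carrier D - {\<zero>\<^bsub>D\<^esub>}),
    zero = Inl \<zero>\<^bsub>C\<^esub>,
    add = (\<lambda>x y. case (x, y) of
        (Inl c, Inl c') \<Rightarrow> Inl (c \<oplus>\<^bsub>C\<^esub> c')
      | (Inl c, Inr d) \<Rightarrow> Inr d
      | (Inr d, Inl c) \<Rightarrow> Inr d
      | (Inr d, Inr d') \<Rightarrow> osum_inr C D (d \<oplus>\<^bsub>D\<^esub> d')),
    imp = (\<lambda>x y. case (x, y) of
        (Inl c, Inl c') \<Rightarrow> Inl (c \<rightharpoonup>\<^bsub>C\<^esub> c')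
      | (Inl c, Inr d) \<Rightarrow> Inr d
      | (Inr d, Inl c) \<Rightarrow> Inl \<zero>\<^bsub>C\<^esub>
      | (Inr d, Inr d') \<Rightarrow> osum_inr C D (d \<rightharpoonup>\<^bsub>D\<^esub> d'))\<rparr>"

definition pocrim_iso ::
    "('a, 'm) pocrim_struct_scheme \<Rightarrow> ('b, 'n) pocrim_struct_scheme \<Rightarrow> ('a \<Rightarrow> 'b) set"
  where "pocrim_iso A B = {f. bij_betw f (carrier A) (carrier B) \<and>
    f \<zero>\<^bsub>A\<^esub> = \<zero>\<^bsub>B\<^esub> \<and>
    (\<forall>x \<in> carrier A. \<forall>y \<in> carrier A.
      f (x \<oplus>\<^bsub>A\<^esub> y) = f x \<oplus>\<^bsub>B\<^esub> f y \<and> f (x \<rightharpoonup>\<^bsub>A\<^esub> y) = f x \<rightharpoonup>\<^bsub>B\<^esub> f y)}"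

text \<open>Taking the summands over the type of \<open>H\<close> loses nothing, since they embed into \<open>H\<close>. An
  isomorphism preserves a top element without being required to: \<open>1\<close> is the only
  element with \<open>x + 1 = 1\<close> for all \<open>x\<close>.\<close>

definition is_ordinal_sum ::
    "('a, 'm) pocrim_struct_scheme \<Rightarrow> 'a pocrim_struct \<Rightarrow> 'a pocrim_struct \<Rightarrow> bool"
  where "is_ordinal_sum H S F \<longleftrightarrow> pocrim S \<and> pocrim F \<and> pocrim_iso H (S \<frown> F) \<noteq> {}"


inductive_set hoop_generate :: "('a, 'm) pocrim_struct_scheme \<Rightarrow> 'a set \<Rightarrow> 'a set"
  for H and X where
    zero: "\<zero>\<^bsub>H\<^esub> \<in> hoop_generate H X"
  | incl: "x \<in> X \<Longrightarrow> x \<in> hoop_generate H X"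
  | add: "x \<in> hoop_generate H X \<Longrightarrow> y \<in> hoop_generate H X \<Longrightarrow> x \<oplus>\<^bsub>H\<^esub> y \<in> hoop_generate H X"
  | imp: "x \<in> hoop_generate H X \<Longrightarrow> y \<in> hoop_generate H X \<Longrightarrow> x \<rightharpoonup>\<^bsub>H\<^esub> y \<in> hoop_generate H X"

inductive_set bounded_hoop_generate ::
    "('a, 'm) bounded_pocrim_struct_scheme \<Rightarrow> 'a set \<Rightarrow> 'a set"
  for H and X where
    zero: "\<zero>\<^bsub>H\<^esub> \<in> bounded_hoop_generate H X"
  | top: "top_elem H \<in> bounded_hoop_generate H X"
  | incl: "x \<in> X \<Longrightarrow> x \<in> bounded_hoop_generate H X"
  | add: "x \<in> bounded_hoop_generate H X \<Longrightarrow> y \<in> bounded_hoop_generate H X \<Longrightarrow>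
      x \<oplus>\<^bsub>H\<^esub> y \<in> bounded_hoop_generate H X"
  | imp: "x \<in> bounded_hoop_generate H X \<Longrightarrow> y \<in> bounded_hoop_generate H X \<Longrightarrow>
      x \<rightharpoonup>\<^bsub>H\<^esub> y \<in> bounded_hoop_generate H X"


text \<open>Terms in the languages \<open>(0, +, \<rightarrow>)\<close> and \<open>(0, 1, +, \<rightarrow>)\<close>.\<close>

datatype hoop_term =
  HVar nat | HZero | HAdd hoop_term hoop_term | HImp hoop_term hoop_term

datatype bounded_hoop_term =
  BVar nat | BZero | BOne
  | BAdd bounded_hoop_term bounded_hoop_term | BImp bounded_hoop_term bounded_hoop_term

primrec hoop_term_vars :: "hoop_term \<Rightarrow> nat set" where
  "hoop_term_vars (HVar i) = {i}"
| "hoop_term_vars HZero = {}"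
| "hoop_term_vars (HAdd s t) = hoop_term_vars s \<union> hoop_term_vars t"
| "hoop_term_vars (HImp s t) = hoop_term_vars s \<union> hoop_term_vars t"

primrec bounded_hoop_term_vars :: "bounded_hoop_term \<Rightarrow> nat set" where
  "bounded_hoop_term_vars (BVar i) = {i}"
| "bounded_hoop_term_vars BZero = {}"
| "bounded_hoop_term_vars BOne = {}"
| "bounded_hoop_term_vars (BAdd s t) = bounded_hoop_term_vars s \<union> bounded_hoop_term_vars t"
| "bounded_hoop_term_vars (BImp s t) = bounded_hoop_term_vars s \<union> bounded_hoop_term_vars t"

primrec hoop_term_val :: "('a, 'm) pocrim_struct_scheme \<Rightarrow> (nat \<Rightarrow> 'a) \<Rightarrow> hoop_term \<Rightarrow> 'a" where
  "hoop_term_val H x (HVar i) = x i"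
| "hoop_term_val H x HZero = \<zero>\<^bsub>H\<^esub>"
| "hoop_term_val H x (HAdd s t) = hoop_term_val H x s \<oplus>\<^bsub>H\<^esub> hoop_term_val H x t"
| "hoop_term_val H x (HImp s t) = hoop_term_val H x s \<rightharpoonup>\<^bsub>H\<^esub> hoop_term_val H x t"

primrec bounded_hoop_term_val ::
    "('a, 'm) bounded_pocrim_struct_scheme \<Rightarrow> (nat \<Rightarrow> 'a) \<Rightarrow> bounded_hoop_term \<Rightarrow> 'a" where
  "bounded_hoop_term_val H x (BVar i) = x i"
| "bounded_hoop_term_val H x BZero = \<zero>\<^bsub>H\<^esub>"
| "bounded_hoop_term_val H x BOne = top_elem H"
| "bounded_hoop_term_val H x (BAdd s t) =
    bounded_hoop_term_val H x s \<oplus>\<^bsub>H\<^esub> bounded_hoop_term_val H x t"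
| "bounded_hoop_term_val H x (BImp s t) =
    bounded_hoop_term_val H x s \<rightharpoonup>\<^bsub>H\<^esub> bounded_hoop_term_val H x t"

end

(* An identity that fails in some hoop fails in the countable subhoop generated by the variables.
   Dividing by an ideal that is maximal among those omitting a nonzero difference u of the two sides
   gives a hoop in which u lies in every nonzero ideal. Following Blok and Ferreirim, the elements x
   with u -> x = x form the upper summand F of an ordinal sum, and 0 together with the other elements
   forms the lower summand S, which contains u and is Wajsberg. Such a countermodel is countable, so
   it can be realized over any infinite type, and this gives both directions of the equivalence. *)
theory Submission
  imports Defs "HOL-Library.Countable_Set"
begin

section \<open>Pocrims and hoops\<close>

text \<open>A statement cannot quantify over types, so the theorem compares hoops over one infinite
  type with restricted hoops over another. When the types differ, passing from all hoops to the
  restricted ones is not a specialisation: a failure over the second type has to be rebuilt over the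
  first. The same construction therefore serves both directions. The quotient is used through an
  archimedean property: every nonzero element has a multiple above \<open>u\<close>. It enters at
  three places: it puts the nonzero elements of \<open>Fix\<close> above \<open>u\<close>, it yields
  the Wajsberg law on \<open>Low\<close>, and it puts the pair of \<open>u\<close> and zero into
  every congruence of \<open>Low\<close> other than the identity. As \<open>u\<close> is a nonzero
  element of \<open>Low\<close>, neither the lower summand nor the whole hoop is trivial.\<close>

context pocrim
begin

lemma zero_closed [simp, intro]: "\<zero> \<in> carrier P"
  using comm_monoid.axioms(1)[OF add_comm_monoid] monoid.one_closed by fastforce

lemma add_closed [simp, intro]:
  "\<lbrakk>x \<in> carrier P; y \<in> carrier P\<rbrakk> \<Longrightarrow> x \<oplus> y \<in> carrier P"
  using comm_monoid.axioms(1)[OF add_comm_monoid] monoid.m_closed by fastforce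

declare imp_closed [simp, intro]

lemma add_assoc:
  "\<lbrakk>x \<in> carrier P; y \<in> carrier P; z \<in> carrier P\<rbrakk> \<Longrightarrow> (x \<oplus> y) \<oplus> z = x \<oplus> (y \<oplus> z)"
  using monoid.m_assoc[OF comm_monoid.axioms(1)[OF add_comm_monoid]] by simp

lemma add_commute: "\<lbrakk>x \<in> carrier P; y \<in> carrier P\<rbrakk> \<Longrightarrow> x \<oplus> y = y \<oplus> x"
  using comm_monoid.m_comm[OF add_comm_monoid] by simp

lemma zero_add [simp]: "x \<in> carrier P \<Longrightarrow> \<zero> \<oplus> x = x"
  using monoid.l_one[OF comm_monoid.axioms(1)[OF add_comm_monoid]] by simp

lemma add_zero [simp]: "x \<in> carrier P \<Longrightarrow> x \<oplus> \<zero> = x"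
  using add_commute[of x \<zero>] by simp

lemma add_left_commute:
  "\<lbrakk>x \<in> carrier P; y \<in> carrier P; z \<in> carrier P\<rbrakk> \<Longrightarrow> x \<oplus> (y \<oplus> z) = y \<oplus> (x \<oplus> z)"
  by (metis add_assoc add_commute)

lemmas add_ac = add_assoc add_commute add_left_commute

lemma geq_refl [simp]: "x \<in> carrier P \<Longrightarrow> x \<succeq> x"
  using geq_partial_order by (auto simp: partial_order_on_def preorder_on_def refl_on_def)

lemma geq_trans:
  "\<lbrakk>x \<succeq> y; y \<succeq> z; x \<in> carrier P; y \<in> carrier P; z \<in> carrier P\<rbrakk> \<Longrightarrow> x \<succeq> z"
  using geq_partial_order unfolding partial_order_on_def preorder_on_def trans_def by blast

lemma geq_antisym: "\<lbrakk>x \<succeq> y; y \<succeq> x; x \<in> carrier P; y \<in> carrier P\<rbrakk> \<Longrightarrow> x = y"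
  using geq_partial_order unfolding partial_order_on_def antisym_def by blast

lemma imp_self [simp]: "x \<in> carrier P \<Longrightarrow> x \<rightharpoonup> x = \<zero>"
  using geq_refl unfolding geq_def .

lemma imp_zero [simp]: "x \<in> carrier P \<Longrightarrow> x \<rightharpoonup> \<zero> = \<zero>"
  using geq_zero unfolding geq_def .

lemma zero_geq: "\<lbrakk>\<zero> \<succeq> x; x \<in> carrier P\<rbrakk> \<Longrightarrow> x = \<zero>"
  using geq_antisym geq_zero by blast

lemma zero_imp [simp]:
  assumes "x \<in> carrier P" shows "\<zero> \<rightharpoonup> x = x"
  using assms residuation[of x \<zero> x] residuation[of "\<zero> \<rightharpoonup> x" \<zero> x] geq_antisym by simp

text \<open>By residuation and associativity both sides have the same elements above them.\<close>

lemma add_imp: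
  assumes "x \<in> carrier P" "y \<in> carrier P" "z \<in> carrier P"
  shows "(x \<oplus> y) \<rightharpoonup> z = x \<rightharpoonup> (y \<rightharpoonup> z)"
proof -
  have "w \<succeq> (x \<oplus> y) \<rightharpoonup> z \<longleftrightarrow> w \<succeq> x \<rightharpoonup> (y \<rightharpoonup> z)" if "w \<in> carrier P" for w
    using assms that by (simp flip: residuation add: add_assoc)
  then show ?thesis
    using assms by (metis geq_antisym geq_refl add_closed imp_closed)
qed

lemma imp_left_commute:
  "\<lbrakk>x \<in> carrier P; y \<in> carrier P; z \<in> carrier P\<rbrakk> \<Longrightarrow> x \<rightharpoonup> (y \<rightharpoonup> z) = y \<rightharpoonup> (x \<rightharpoonup> z)"
  by (metis add_commute add_imp)

lemma add_geq_left: "\<lbrakk>x \<in> carrier P; y \<in> carrier P\<rbrakk> \<Longrightarrow> x \<oplus> y \<succeq> x"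
  using add_mono[of y \<zero> x] geq_zero[of y] by (simp add: add_commute)

lemma add_geq_right: "\<lbrakk>x \<in> carrier P; y \<in> carrier P\<rbrakk> \<Longrightarrow> x \<oplus> y \<succeq> y"
  using add_geq_left[of y x] by (simp add: add_commute)

lemma add_mono2:
  assumes "x \<succeq> x'" "y \<succeq> y'"
    "x \<in> carrier P" "x' \<in> carrier P" "y \<in> carrier P" "y' \<in> carrier P"
  shows "x \<oplus> y \<succeq> x' \<oplus> y'"
proof (rule geq_trans)
  show "x \<oplus> y \<succeq> x' \<oplus> y" using assms by (simp add: add_mono)
  show "x' \<oplus> y \<succeq> x' \<oplus> y'" using assms add_mono[of y y' x'] by (simp add: add_commute)
qed (use assms in auto)

lemma geq_imp: "\<lbrakk>x \<in> carrier P; y \<in> carrier P\<rbrakk> \<Longrightarrow> y \<succeq> x \<rightharpoonup> y"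
  by (simp flip: residuation add: add_geq_left)

lemma modus_ponens: "\<lbrakk>x \<in> carrier P; y \<in> carrier P\<rbrakk> \<Longrightarrow> x \<oplus> (x \<rightharpoonup> y) \<succeq> y"
  using residuation[of "x \<rightharpoonup> y" x y] by (simp add: add_commute)

lemma geq_imp_imp: "\<lbrakk>x \<in> carrier P; y \<in> carrier P\<rbrakk> \<Longrightarrow> x \<succeq> (x \<rightharpoonup> y) \<rightharpoonup> y"
  by (metis imp_closed modus_ponens residuation)

lemma imp_mono:
  assumes "y \<succeq> z" "x \<in> carrier P" "y \<in> carrier P" "z \<in> carrier P"
  shows "x \<rightharpoonup> y \<succeq> x \<rightharpoonup> z"
proof -
  have "(x \<rightharpoonup> y) \<oplus> x \<succeq> z"
    using assms modus_ponens[of x y] geq_trans[of "(x \<rightharpoonup> y) \<oplus> x" y z] by (simp add: add_commute)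
  then show ?thesis using assms by (simp add: residuation)
qed

lemma imp_antimono:
  assumes "x \<succeq> y" "x \<in> carrier P" "y \<in> carrier P" "z \<in> carrier P"
  shows "y \<rightharpoonup> z \<succeq> x \<rightharpoonup> z"
proof -
  have "(y \<rightharpoonup> z) \<oplus> x \<succeq> (y \<rightharpoonup> z) \<oplus> y" using assms by (intro add_mono2) auto
  moreover have "(y \<rightharpoonup> z) \<oplus> y \<succeq> z" using assms modus_ponens[of y z] by (simp add: add_commute)
  ultimately have "(y \<rightharpoonup> z) \<oplus> x \<succeq> z" using assms geq_trans by (meson add_closed imp_closed)
  then show ?thesis using assms by (simp add: residuation)
qed

text \<open>The map \<open>_ -> y\<close> is antitone and forms a Galois connection with itself, so
  three applications collapse to one.\<close>

lemma imp_imp_imp: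
  assumes "x \<in> carrier P" "y \<in> carrier P"
  shows "((x \<rightharpoonup> y) \<rightharpoonup> y) \<rightharpoonup> y = x \<rightharpoonup> y"
  using assms by (intro geq_antisym imp_antimono geq_imp_imp) auto

lemma imp_triangle:
  assumes "x \<in> carrier P" "y \<in> carrier P" "z \<in> carrier P"
  shows "(x \<rightharpoonup> y) \<oplus> (y \<rightharpoonup> z) \<succeq> x \<rightharpoonup> z"
proof -
  have "x \<oplus> (x \<rightharpoonup> y) \<oplus> (y \<rightharpoonup> z) \<succeq> y \<oplus> (y \<rightharpoonup> z)"
    using assms by (intro add_mono2 modus_ponens) auto
  moreover have "y \<oplus> (y \<rightharpoonup> z) \<succeq> z" using assms by (simp add: modus_ponens)
  ultimately have "x \<oplus> (x \<rightharpoonup> y) \<oplus> (y \<rightharpoonup> z) \<succeq> z" using assms geq_trans by (meson add_closed imp_closed)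
  then have "((x \<rightharpoonup> y) \<oplus> (y \<rightharpoonup> z)) \<oplus> x \<succeq> z" using assms by (simp add: add_ac)
  then show ?thesis using assms by (simp add: residuation)
qed

fun multiple :: "nat \<Rightarrow> 'a \<Rightarrow> 'a" where
  "multiple 0 x = \<zero>"
| "multiple (Suc n) x = x \<oplus> multiple n x"

lemma multiple_closed [simp, intro]: "x \<in> carrier P \<Longrightarrow> multiple n x \<in> carrier P"
  by (induction n) auto

lemma multiple_add: "x \<in> carrier P \<Longrightarrow> multiple (m + n) x = multiple m x \<oplus> multiple n x"
  by (induction m) (auto simp: add_assoc)

text \<open>By \<open>add_imp\<close> a sum acts as the composite of its summands. In
  \<open>imp_imp_Low\<close> this turns a fixed point of \<open>c\<close> into one of
  \<open>u\<close>.\<close>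

lemma multiple_imp_fixed:
  "\<lbrakk>x \<rightharpoonup> y = y; x \<in> carrier P; y \<in> carrier P\<rbrakk> \<Longrightarrow> multiple n x \<rightharpoonup> y = y"
  by (induction n) (auto simp: add_imp)

end

section \<open>The natural order of a hoop and its equational axioms\<close>

lemma (in hoop) geq_decomp:
  assumes "x \<succeq> y" "x \<in> carrier P" "y \<in> carrier P"
  shows "y \<oplus> (y \<rightharpoonup> x) = x"
  using assms divisibility[of x y] by (simp add: geq_def)

text \<open>Apart from closure the hypotheses are identities, so they pass to subalgebras and to
  images under maps that preserve the operations. Antisymmetry of the order is not an identity and
  would not transfer directly to images.\<close>

lemma hoopI:
  fixes P (structure)
  assumes add_closed: "\<And>x y. \<lbrakk>x \<in> carrier P; y \<in> carrier P\<rbrakk> \<Longrightarrow> x \<oplus> y \<in> carrier P"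
    and imp_closed: "\<And>x y. \<lbrakk>x \<in> carrier P; y \<in> carrier P\<rbrakk> \<Longrightarrow> x \<rightharpoonup> y \<in> carrier P"
    and zero_closed: "\<zero> \<in> carrier P"
    and add_assoc: "\<And>x y z. \<lbrakk>x \<in> carrier P; y \<in> carrier P; z \<in> carrier P\<rbrakk> \<Longrightarrow>
      (x \<oplus> y) \<oplus> z = x \<oplus> (y \<oplus> z)"
    and add_commute: "\<And>x y. \<lbrakk>x \<in> carrier P; y \<in> carrier P\<rbrakk> \<Longrightarrow> x \<oplus> y = y \<oplus> x"
    and zero_add: "\<And>x. x \<in> carrier P \<Longrightarrow> \<zero> \<oplus> x = x"
    and imp_self: "\<And>x. x \<in> carrier P \<Longrightarrow> x \<rightharpoonup> x = \<zero>"
    and imp_zero: "\<And>x. x \<in> carrier P \<Longrightarrow> x \<rightharpoonup> \<zero> = \<zero>"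
    and add_imp: "\<And>x y z. \<lbrakk>x \<in> carrier P; y \<in> carrier P; z \<in> carrier P\<rbrakk> \<Longrightarrow>
      (x \<oplus> y) \<rightharpoonup> z = x \<rightharpoonup> (y \<rightharpoonup> z)"
    and div: "\<And>x y. \<lbrakk>x \<in> carrier P; y \<in> carrier P\<rbrakk> \<Longrightarrow> x \<oplus> (x \<rightharpoonup> y) = y \<oplus> (y \<rightharpoonup> x)"
  shows "hoop P"
proof -
  note closed = add_closed imp_closed zero_closed
  \<comment> \<open>Divisibility makes the order natural: whatever lies above \<open>y\<close> is a
    sum with summand \<open>y\<close>. Transitivity, antisymmetry and monotonicity of addition
    follow from this.\<close>
  have decomp: "x = (y \<rightharpoonup> x) \<oplus> y" if "x \<rightharpoonup> y = \<zero>" "x \<in> carrier P" "y \<in> carrier P" for x y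
    using that div[of x y] closed zero_add[of x] add_commute by metis
  have trans: "x \<rightharpoonup> z = \<zero>"
    if "x \<rightharpoonup> y = \<zero>" "y \<rightharpoonup> z = \<zero>" "x \<in> carrier P" "y \<in> carrier P" "z \<in> carrier P" for x y z
    using that decomp[of x y] add_imp[of "y \<rightharpoonup> x" y z] imp_zero closed by metis
  have antisym: "x = y" if "x \<rightharpoonup> y = \<zero>" "y \<rightharpoonup> x = \<zero>" "x \<in> carrier P" "y \<in> carrier P" for x y
    using that decomp[of x y] zero_add[of y] by simp
  have mono: "(x \<oplus> z) \<rightharpoonup> (y \<oplus> z) = \<zero>"
    if "x \<rightharpoonup> y = \<zero>" "x \<in> carrier P" "y \<in> carrier P" "z \<in> carrier P" for x y z
  proof -
    have "x \<oplus> z = (y \<rightharpoonup> x) \<oplus> (y \<oplus> z)"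
      using that decomp[of x y] add_assoc[of "y \<rightharpoonup> x" y z] closed by metis
    then show ?thesis
      using that add_imp[of "y \<rightharpoonup> x" "y \<oplus> z" "y \<oplus> z"] closed by (simp add: imp_self imp_zero)
  qed
  show ?thesis
  proof (intro hoop.intro pocrim.intro hoop_axioms.intro)
    show "comm_monoid \<lparr>carrier = carrier P, mult = add P, one = \<zero>\<rparr>"
      by (rule comm_monoidI) (auto simp: closed add_assoc zero_add intro: add_commute)
    show "partial_order_on (carrier P) {(x, y). x \<in> carrier P \<and> y \<in> carrier P \<and> x \<succeq> y}"
      unfolding partial_order_on_def preorder_on_def
      by (auto simp: refl_on_def trans_def antisym_def geq_def imp_self intro: trans antisym)
  qed (auto simp: geq_def closed imp_zero div mono, simp_all add: add_imp)
qed

section \<open>The ordinal sum decomposition\<close>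

text \<open>Further record fields, such as a top element, are dropped, which gives the type that
  \<open>ordinal_sum\<close> takes for its summands.\<close>

definition subalgebra :: "('a, 'm) pocrim_struct_scheme \<Rightarrow> 'a set \<Rightarrow> 'a pocrim_struct"
  where "subalgebra P A = \<lparr>carrier = A, zero = zero P, add = add P, imp = imp P\<rparr>"

lemma subalgebra_simps [simp]:
  "carrier (subalgebra P A) = A" "zero (subalgebra P A) = zero P"
  "add (subalgebra P A) = add P" "imp (subalgebra P A) = imp P"
  by (simp_all add: subalgebra_def)

lemma (in hoop) hoop_subalgebra:
  assumes "A \<subseteq> carrier P" "\<zero> \<in> A" "\<And>x y. \<lbrakk>x \<in> A; y \<in> A\<rbrakk> \<Longrightarrow> x \<oplus> y \<in> A"
    "\<And>x y. \<lbrakk>x \<in> A; y \<in> A\<rbrakk> \<Longrightarrow> x \<rightharpoonup> y \<in> A"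
  shows "hoop (subalgebra P A)"
proof -
  have [simp]: "x \<in> carrier P" if "x \<in> A" for x using assms(1) that by auto
  show ?thesis
    by (rule hoopI)
      (use assms in \<open>auto simp: add_assoc add_imp intro: add_commute divisibility\<close>)
qed

text \<open>By the archimedean hypothesis \<open>u\<close> lies in every nonzero ideal, so this is an explicit form of
  subdirect irreducibility of a nontrivial hoop.\<close>

locale si_hoop = hoop P for P :: "('a, 'm) pocrim_struct_scheme" (structure) +
  fixes u :: 'a
  assumes u_closed [simp, intro]: "u \<in> carrier P"
    and u_nonzero: "u \<noteq> \<zero>"
    and archimedean: "\<lbrakk>x \<in> carrier P; x \<noteq> \<zero>\<rbrakk> \<Longrightarrow> \<exists>n. multiple n x \<succeq> u"
begin

definition Fix :: "'a set" where "Fix = {x \<in> carrier P. u \<rightharpoonup> x = x}"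

definition Low :: "'a set" where "Low = insert \<zero> (carrier P - Fix)"

lemma zero_in_Fix [simp]: "\<zero> \<in> Fix" and zero_in_Low [simp]: "\<zero> \<in> Low"
  by (auto simp: Fix_def Low_def)

lemma Fix_Low_disjoint: "\<lbrakk>x \<in> Fix; x \<in> Low\<rbrakk> \<Longrightarrow> x = \<zero>"
  by (auto simp: Low_def)

lemma Low_cases: "x \<in> carrier P \<Longrightarrow> x \<in> Low \<or> x \<in> Fix"
  by (auto simp: Low_def)

lemma u_in_Low: "u \<in> Low"
  using u_nonzero by (auto simp: Low_def Fix_def)

section \<open>Arithmetic of \<open>Fix\<close> and its position above \<open>Low\<close>\<close>

lemma FixI: "\<lbrakk>u \<rightharpoonup> x = x; x \<in> carrier P\<rbrakk> \<Longrightarrow> x \<in> Fix"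
  by (simp add: Fix_def)

lemma Fix_closed [simp]: "x \<in> Fix \<Longrightarrow> x \<in> carrier P"
  and u_imp_Fix [simp]: "x \<in> Fix \<Longrightarrow> u \<rightharpoonup> x = x"
  by (simp_all add: Fix_def)

lemma Low_closed [simp]: "x \<in> Low \<Longrightarrow> x \<in> carrier P"
  by (auto simp: Low_def)

text \<open>By antitonicity \<open>m -> x\<close> is squeezed between \<open>u -> x = x\<close> and
  \<open>x\<close>.\<close>

lemma Fix_imp_eq:
  assumes "x \<in> Fix" "u \<succeq> m" "m \<in> carrier P" shows "m \<rightharpoonup> x = x"
proof (rule geq_antisym)
  show "m \<rightharpoonup> x \<succeq> x"
    using assms imp_antimono[of u m x] by simp
qed (use assms in \<open>auto simp: geq_imp\<close>)

text \<open>With \<open>q k = (multiple k x -> u)\<close>, the sum \<open>q k + x\<close> does not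
  depend on \<open>k\<close>: divisibility turns \<open>x + (x -> q k)\<close> into
  \<open>q k + (q k -> x)\<close>, and \<open>q k\<close> lies below \<open>u\<close>, hence fixes
  \<open>x\<close>. The sum is \<open>u + x\<close> for \<open>k = 0\<close>, and it is
  \<open>x\<close> as soon as \<open>multiple k x\<close> lies above \<open>u\<close>.\<close>

lemma Fix_geq_u:
  assumes x: "x \<in> Fix" "x \<noteq> \<zero>" shows "x \<succeq> u"
proof -
  have *: "(multiple k x \<rightharpoonup> u) \<oplus> x = u \<oplus> x" for k
  proof (induction k)
    case (Suc k)
    let ?q = "multiple k x \<rightharpoonup> u"
    have "(multiple (Suc k) x \<rightharpoonup> u) \<oplus> x = x \<oplus> (x \<rightharpoonup> ?q)"
      using x by (simp add: add_imp add_commute)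
    also have "\<dots> = ?q \<oplus> (?q \<rightharpoonup> x)" using x by (intro divisibility) auto
    also have "?q \<rightharpoonup> x = x" using x by (intro Fix_imp_eq) (auto simp: geq_imp)
    finally show ?case using Suc by simp
  qed (use x in simp)
  obtain n where "multiple n x \<succeq> u" using archimedean[of x] x by auto
  then have "u \<oplus> x = x" using *[of n] x by (simp add: geq_def)
  then show ?thesis using add_geq_left[of u x] x by simp
qed

lemma u_add_Fix: "\<lbrakk>x \<in> Fix; x \<noteq> \<zero>\<rbrakk> \<Longrightarrow> u \<oplus> x = x"
  using geq_decomp[OF Fix_geq_u, of x] by simp

lemma imp_in_Fix: "\<lbrakk>x \<in> carrier P; y \<in> Fix\<rbrakk> \<Longrightarrow> x \<rightharpoonup> y \<in> Fix"
  by (intro FixI) (auto simp: imp_left_commute[of u x])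

text \<open>The sum \<open>u + y\<close> is \<open>y\<close>, so a further premise \<open>u\<close>
  is absorbed. That \<open>x\<close> may be arbitrary matters in \<open>Fix_geq_Low\<close>, where
  it comes from \<open>Low\<close>.\<close>

lemma Fix_imp_in_Fix:
  assumes "y \<in> Fix" "y \<noteq> \<zero>" "x \<in> carrier P" shows "y \<rightharpoonup> x \<in> Fix"
  using add_imp[of u y x, symmetric] u_add_Fix[of y] assms by (intro FixI) auto

text \<open>Put \<open>z = (u -> x + y)\<close>. Then \<open>u + z = x + y\<close>, while
  \<open>z\<close> lies above \<open>u -> x = x\<close> and so has \<open>x\<close> as a summand.
  Since \<open>x\<close> absorbs \<open>u\<close>, so does \<open>z\<close>, whence
  \<open>z = x + y\<close>.\<close>

lemma add_in_Fix:
  assumes "x \<in> Fix" "y \<in> Fix" shows "x \<oplus> y \<in> Fix"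
proof (cases "x = \<zero> \<or> y = \<zero>")
  case False
  define z where "z = u \<rightharpoonup> (x \<oplus> y)"
  have [simp]: "z \<in> carrier P" using assms by (simp add: z_def)
  have "x \<oplus> y \<succeq> u"
    using assms False geq_trans[OF add_geq_left[of x y] Fix_geq_u] by auto
  then have 1: "u \<oplus> z = x \<oplus> y" unfolding z_def using assms by (intro geq_decomp) auto
  have "z \<succeq> u \<rightharpoonup> x" unfolding z_def using assms by (intro imp_mono add_geq_left) auto
  then have 2: "x \<oplus> (x \<rightharpoonup> z) = z" using assms by (intro geq_decomp) auto
  have "u \<oplus> z = (u \<oplus> x) \<oplus> (x \<rightharpoonup> z)" using assms 2 by (simp add: add_assoc)
  also have "\<dots> = z" using assms False 2 by (simp add: u_add_Fix)
  finally show ?thesis using 1 assms by (intro FixI) (auto simp: z_def)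
qed (use assms in auto)

text \<open>Otherwise \<open>g = (y -> x)\<close> is nonzero. Both \<open>g\<close> and
  \<open>g -> x\<close> are in \<open>Fix\<close>, and they add up to \<open>x\<close>, so
  \<open>x\<close> would be in \<open>Fix\<close> too and hence zero.\<close>

lemma Fix_geq_Low:
  assumes x: "x \<in> Low" and y: "y \<in> Fix" "y \<noteq> \<zero>"
  shows "y \<succeq> x"
proof (rule ccontr)
  define g where "g = y \<rightharpoonup> x"
  assume "\<not> y \<succeq> x"
  then have g: "g \<noteq> \<zero>" "g \<in> Fix"
    using assms Fix_imp_in_Fix by (auto simp: g_def geq_def)
  have "x \<succeq> g" using assms by (simp add: g_def geq_imp)
  then have "g \<oplus> (g \<rightharpoonup> x) = x" using x g by (intro geq_decomp) auto
  moreover have "g \<rightharpoonup> x \<in> Fix" using g x by (intro Fix_imp_in_Fix) auto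
  ultimately have "x \<in> Fix" using add_in_Fix[of g "g \<rightharpoonup> x"] g by simp
  then have "x = \<zero>" using x Fix_Low_disjoint by blast
  with \<open>\<not> y \<succeq> x\<close> y show False by (simp add: geq_zero)
qed

text \<open>The element \<open>(x -> y) -> y\<close> is in \<open>Fix\<close> and below
  \<open>x\<close>. Were it nonzero, it would also lie above \<open>x\<close> by
  \<open>Fix_geq_Low\<close>, and \<open>x\<close> would be in \<open>Fix\<close>. So it is zero,
  which puts \<open>x -> y\<close> above \<open>y\<close>.\<close>

lemma Low_imp_Fix:
  assumes x: "x \<in> Low" and y: "y \<in> Fix" "y \<noteq> \<zero>"
  shows "x \<rightharpoonup> y = y"
proof (cases "x = \<zero>")
  case False
  define k where "k = x \<rightharpoonup> y"
  have k: "k \<in> Fix" using assms by (simp add: k_def imp_in_Fix)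
  have "x \<notin> Fix" using False x Fix_Low_disjoint by blast
  have "k \<noteq> \<zero>"
  proof
    assume "k = \<zero>"
    then have "x = y" using assms Fix_geq_Low by (intro geq_antisym) (auto simp: k_def geq_def)
    then show False using y \<open>x \<notin> Fix\<close> by simp
  qed
  have "k \<rightharpoonup> y = \<zero>"
  proof (rule ccontr)
    assume "k \<rightharpoonup> y \<noteq> \<zero>"
    moreover have c: "k \<rightharpoonup> y \<in> Fix" using k y by (simp add: imp_in_Fix)
    ultimately have "k \<rightharpoonup> y \<succeq> x" using x by (intro Fix_geq_Low)
    moreover have "x \<succeq> k \<rightharpoonup> y" using assms by (simp add: k_def geq_imp_imp)
    ultimately have "k \<rightharpoonup> y = x" using x k y by (intro geq_antisym) auto
    then show False using c \<open>x \<notin> Fix\<close> by simp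
  qed
  then have "k = y"
    using assms k geq_imp[of x y] by (intro geq_antisym) (auto simp: k_def geq_def)
  then show ?thesis by (simp add: k_def)
qed (use y in simp)

lemma Low_add_Fix:
  assumes "x \<in> Low" "y \<in> Fix" "y \<noteq> \<zero>"
  shows "x \<oplus> y = y"
  using geq_decomp[OF Fix_geq_Low[OF assms]] Low_imp_Fix[OF assms] assms by simp

text \<open>If \<open>x + y\<close> were a nonzero element of \<open>Fix\<close>, then
  \<open>x -> x + y\<close> would equal \<open>x + y\<close>. As it always lies below
  \<open>y\<close>, this forces \<open>x + y = y\<close>, an element of \<open>Low\<close>.\<close>

lemma add_in_Low:
  assumes "x \<in> Low" "y \<in> Low" shows "x \<oplus> y \<in> Low"
proof (rule ccontr)
  assume *: "x \<oplus> y \<notin> Low"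
  then have F: "x \<oplus> y \<in> Fix" "x \<oplus> y \<noteq> \<zero>" using assms Low_cases[of "x \<oplus> y"] by auto
  then have "x \<rightharpoonup> (x \<oplus> y) = x \<oplus> y" using assms by (intro Low_imp_Fix)
  moreover have "y \<succeq> x \<rightharpoonup> (x \<oplus> y)"
    using assms by (simp flip: residuation add: add_commute)
  ultimately have "y = x \<oplus> y" using assms add_geq_right by (intro geq_antisym) auto
  then show False using * assms by simp
qed

text \<open>A nonzero value in \<open>Fix\<close> would lie above \<open>y\<close> by
  \<open>Fix_geq_Low\<close>. An implication with conclusion \<open>y\<close> always lies below
  \<open>y\<close>, so the value would be \<open>y\<close> itself.\<close>

lemma imp_in_Low:
  assumes "x \<in> Low" "y \<in> Low" shows "x \<rightharpoonup> y \<in> Low"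
proof (rule ccontr)
  assume *: "x \<rightharpoonup> y \<notin> Low"
  then have F: "x \<rightharpoonup> y \<in> Fix" "x \<rightharpoonup> y \<noteq> \<zero>" using assms Low_cases[of "x \<rightharpoonup> y"] by auto
  then have "x \<rightharpoonup> y \<succeq> y" using assms Fix_geq_Low by simp
  then have "x \<rightharpoonup> y = y" using assms by (intro geq_antisym geq_imp) auto
  then show False using * assms by simp
qed

text \<open>The defect \<open>c\<close> satisfies \<open>x = c + x2\<close>, and
  \<open>x2 -> y\<close> is again \<open>k\<close>, so \<open>c -> k = k\<close>. If
  \<open>c\<close> were nonzero, a multiple of it would lie above \<open>u\<close> and still fix
  \<open>k\<close>, so \<open>k\<close> would be in both \<open>Fix\<close> and \<open>Low\<close>
  and hence zero. Then \<open>x = y\<close>, and \<open>c\<close> is zero after all.\<close>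

lemma imp_imp_Low:
  assumes "x \<in> Low" "y \<in> Low" "y \<succeq> x"
  shows "(x \<rightharpoonup> y) \<rightharpoonup> y = x"
proof -
  define k where "k = x \<rightharpoonup> y"
  define x2 where "x2 = k \<rightharpoonup> y"
  define c where "c = x2 \<rightharpoonup> x"
  have [simp]: "k \<in> carrier P" "x2 \<in> carrier P" "c \<in> carrier P"
    using assms by (auto simp: k_def x2_def c_def)
  have x2: "x \<succeq> x2" using assms by (simp add: k_def x2_def geq_imp_imp)
  then have "c \<oplus> x2 = x" using assms geq_decomp[OF x2] by (simp add: c_def add_commute)
  then have ck: "c \<rightharpoonup> k = k"
    using assms add_imp[of c x2 y] imp_imp_imp[of x y] by (simp add: k_def x2_def)
  have "c = \<zero>"
  proof (rule ccontr)
    assume "c \<noteq> \<zero>"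
    then obtain n where "multiple n c \<succeq> u" using archimedean[of c] by auto
    then have "u \<rightharpoonup> k \<succeq> multiple n c \<rightharpoonup> k" by (intro imp_antimono) auto
    then have "u \<rightharpoonup> k = k" using multiple_imp_fixed[OF ck] by (intro geq_antisym geq_imp) auto
    then have "k \<in> Fix" by (simp add: FixI)
    then have "k = \<zero>" using assms imp_in_Low Fix_Low_disjoint by (simp add: k_def)
    moreover from this have "x = y" using assms by (intro geq_antisym) (auto simp: k_def geq_def)
    ultimately show False using \<open>c \<noteq> \<zero>\<close> assms by (simp add: c_def x2_def)
  qed
  then have "x2 = x" using x2 assms by (intro geq_antisym) (auto simp: c_def geq_def)
  then show ?thesis by (simp add: x2_def k_def)
qed

text \<open>One half of the Wajsberg law; exchanging \<open>x\<close> and \<open>y\<close> gives the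
  other. The left side of the law, \<open>w\<close>, is below both \<open>x\<close> and
  \<open>y\<close>: from the first, \<open>imp_imp_Low\<close> gives
  \<open>(w -> x) -> x = w\<close>, and from the second, two uses of antitonicity give the
  comparison.\<close>

lemma imp_imp_Low_mono:
  assumes "x \<in> Low" "y \<in> Low"
  shows "(y \<rightharpoonup> x) \<rightharpoonup> x \<succeq> (x \<rightharpoonup> y) \<rightharpoonup> y"
proof -
  define w where "w = (x \<rightharpoonup> y) \<rightharpoonup> y"
  have w: "w \<in> Low" using assms by (simp add: w_def imp_in_Low)
  have "x \<succeq> w" using assms by (simp add: w_def geq_imp_imp)
  then have "(w \<rightharpoonup> x) \<rightharpoonup> x = w" using w assms by (intro imp_imp_Low)
  moreover have "y \<succeq> w" using assms by (simp add: w_def geq_imp)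
  then have "(y \<rightharpoonup> x) \<rightharpoonup> x \<succeq> (w \<rightharpoonup> x) \<rightharpoonup> x"
    using w assms by (intro imp_antimono) auto
  ultimately show ?thesis by (simp add: w_def)
qed

section \<open>The two summands and the isomorphism\<close>

lemma hoop_Low: "hoop (subalgebra P Low)"
  using add_in_Low imp_in_Low by (intro hoop_subalgebra) auto

lemma hoop_Fix: "hoop (subalgebra P Fix)"
  using add_in_Fix imp_in_Fix by (intro hoop_subalgebra) auto

lemma wajsberg_Low: "wajsberg_hoop (subalgebra P Low)"
  using hoop_Low
  by (auto simp: wajsberg_hoop_def wajsberg_hoop_axioms_def
      intro!: geq_antisym imp_imp_Low_mono)

text \<open>The pair of \<open>u\<close> and zero lies in every congruence that relates distinct
  \<open>x\<close> and \<open>y\<close>. One of \<open>x -> y\<close> and \<open>y -> x\<close> is a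
  nonzero \<open>a\<close> congruent to zero, and so are its multiples. For a multiple above
  \<open>u\<close>, the implication to \<open>u\<close> is zero, yet it is congruent to
  \<open>0 -> u = u\<close>.\<close>

lemma subdirectly_irreducible_Low: "subdirectly_irreducible (subalgebra P Low)"
proof -
  let ?S = "subalgebra P Low"
  have "(u, \<zero>) \<in> \<theta>" if \<theta>: "congruence ?S \<theta>" "\<theta> \<noteq> Id_on Low" for \<theta>
  proof -
    have equiv: "equiv Low \<theta>"
      and add: "\<And>x x' y y'. \<lbrakk>(x, x') \<in> \<theta>; (y, y') \<in> \<theta>\<rbrakk> \<Longrightarrow> (x \<oplus> y, x' \<oplus> y') \<in> \<theta>"
      and imp: "\<And>x x' y y'. \<lbrakk>(x, x') \<in> \<theta>; (y, y') \<in> \<theta>\<rbrakk> \<Longrightarrow> (x \<rightharpoonup> y, x' \<rightharpoonup> y') \<in> \<theta>"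
      using \<theta>(1) by (auto simp: congruence_def)
    have refl: "(x, x) \<in> \<theta>" if "x \<in> Low" for x
      using that equiv equivE refl_onD by metis
    have sub: "\<theta> \<subseteq> Low \<times> Low" using equiv by (simp add: equiv_def refl_on_def)
    obtain x y where xy: "(x, y) \<in> \<theta>" "x \<noteq> y"
      using \<theta>(2) sub refl by (auto simp: Id_on_def)
    have x: "x \<in> Low" and y: "y \<in> Low" using xy sub by auto
    have "(x \<rightharpoonup> y, y \<rightharpoonup> y) \<in> \<theta>" "(x \<rightharpoonup> x, x \<rightharpoonup> y) \<in> \<theta>" "(y \<rightharpoonup> x, y \<rightharpoonup> y) \<in> \<theta>"
      using xy refl[OF x] refl[OF y] imp equivE[OF equiv] by (meson symD)+
    then have "(x \<rightharpoonup> y, \<zero>) \<in> \<theta>" "(y \<rightharpoonup> x, \<zero>) \<in> \<theta>" using x y by auto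
    moreover have "x \<rightharpoonup> y \<noteq> \<zero> \<or> y \<rightharpoonup> x \<noteq> \<zero>"
      using xy x y geq_antisym[of x y] by (auto simp: geq_def)
    ultimately obtain a where a: "(a, \<zero>) \<in> \<theta>" "a \<noteq> \<zero>" by auto
    then have "a \<in> carrier P" using sub by auto
    then obtain n where n: "multiple n a \<succeq> u" using archimedean[of a] a by auto
    have "(multiple n a, \<zero>) \<in> \<theta>"
    proof (induction n)
      case (Suc n)
      then show ?case using add[OF a(1) Suc] by simp
    qed (simp add: refl)
    then have "(multiple n a \<rightharpoonup> u, \<zero> \<rightharpoonup> u) \<in> \<theta>" using refl[OF u_in_Low] by (rule imp)
    then have "(\<zero>, u) \<in> \<theta>" using n by (simp add: geq_def)
    then show ?thesis using equiv by (meson equivE symD)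
  qed
  moreover have "(u, \<zero>) \<notin> Id_on Low" using u_nonzero by auto
  ultimately show ?thesis
    unfolding subdirectly_irreducible_def by auto
qed

theorem is_ordinal_sum_Low_Fix: "is_ordinal_sum P (subalgebra P Low) (subalgebra P Fix)"
proof -
  let ?S = "subalgebra P Low" and ?F = "subalgebra P Fix"
  define f where "f x = (if x \<in> Low then Inl x else Inr x)" for x
  have Fix: "x \<in> Fix" "x \<noteq> \<zero>" if "x \<in> carrier P" "x \<notin> Low" for x
    using that Low_cases by auto
  have "bij_betw f (carrier P) (carrier (?S \<frown> ?F))"
  proof (rule bij_betwI')
    show "f x = f y \<longleftrightarrow> x = y" for x y by (auto simp: f_def)
    show "f x \<in> carrier (?S \<frown> ?F)" if "x \<in> carrier P" for x
      using that Fix by (auto simp: f_def ordinal_sum_def)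
    show "\<exists>x \<in> carrier P. y = f x" if "y \<in> carrier (?S \<frown> ?F)" for y
      using that Fix_Low_disjoint by (force simp: f_def ordinal_sum_def)
  qed
  moreover have
    "f (x \<oplus> y) = f x \<oplus>\<^bsub>?S \<frown> ?F\<^esub> f y \<and> f (x \<rightharpoonup> y) = f x \<rightharpoonup>\<^bsub>?S \<frown> ?F\<^esub> f y"
    if x: "x \<in> carrier P" and y: "y \<in> carrier P" for x y
  proof -
    have f_Low: "f z = Inl z" if "z \<in> Low" for z using that by (simp add: f_def)
    \<comment> \<open>In this form the rule also covers results that are zero, for instance
      \<open>x -> x\<close>, which the ordinal sum sends to the zero of the lower summand.\<close>
    have f_Fix: "f z = osum_inr ?S ?F z" if "z \<in> Fix" for z
    proof (cases "z = \<zero>")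
      case False
      then have "z \<notin> Low" using that Fix_Low_disjoint by blast
      with False show ?thesis by (simp add: f_def osum_inr_def)
    qed (simp add: f_def osum_inr_def)
    have f_Fix_nz: "f z = Inr z" if "z \<in> Fix" "z \<noteq> \<zero>" for z
      using that f_Fix by (simp add: osum_inr_def)
    consider "x \<in> Low" "y \<in> Low" | "x \<in> Low" "y \<in> Fix" "y \<noteq> \<zero>" | "x \<in> Fix" "x \<noteq> \<zero>" "y \<in> Low"
      | "x \<in> Fix" "x \<noteq> \<zero>" "y \<in> Fix" "y \<noteq> \<zero>"
      using Fix x y by blast
    then show ?thesis
    proof cases
      case 1
      then show ?thesis
        by (simp add: f_Low add_in_Low imp_in_Low ordinal_sum_def)
    next
      case 2
      then show ?thesis
        by (simp add: f_Low f_Fix_nz Low_add_Fix Low_imp_Fix ordinal_sum_def)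
    next
      case 3
      have "x \<oplus> y = x" "x \<rightharpoonup> y = \<zero>"
        using 3 Low_add_Fix[of y x] Fix_geq_Low[of y x] add_commute[of y x] by (auto simp: geq_def)
      with 3 show ?thesis
        by (simp add: f_Low f_Fix_nz ordinal_sum_def)
    next
      case 4
      then show ?thesis
        using f_Fix[OF add_in_Fix, of x y] f_Fix[OF imp_in_Fix, of x y]
        by (simp add: f_Fix_nz ordinal_sum_def)
    qed
  qed
  moreover have "f \<zero> = \<zero>\<^bsub>?S \<frown> ?F\<^esub>" by (simp add: f_def ordinal_sum_def)
  ultimately have "f \<in> pocrim_iso P (?S \<frown> ?F)" by (simp add: pocrim_iso_def)
  then show ?thesis
    using hoop_Low hoop_Fix by (auto simp: is_ordinal_sum_def hoop_def)
qed

end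

section \<open>Ideals and homomorphic images\<close>

definition surj_hom ::
    "('a, 'm) pocrim_struct_scheme \<Rightarrow> ('b, 'n) pocrim_struct_scheme \<Rightarrow> ('a \<Rightarrow> 'b) \<Rightarrow> bool"
  where "surj_hom A B f \<longleftrightarrow> f ` carrier A = carrier B \<and> f \<zero>\<^bsub>A\<^esub> = \<zero>\<^bsub>B\<^esub> \<and>
    (\<forall>x \<in> carrier A. \<forall>y \<in> carrier A.
      f (x \<oplus>\<^bsub>A\<^esub> y) = f x \<oplus>\<^bsub>B\<^esub> f y \<and> f (x \<rightharpoonup>\<^bsub>A\<^esub> y) = f x \<rightharpoonup>\<^bsub>B\<^esub> f y)"

lemma surj_homD:
  assumes "surj_hom A B f"
  shows "f ` carrier A = carrier B" "f \<zero>\<^bsub>A\<^esub> = \<zero>\<^bsub>B\<^esub>"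
    "\<lbrakk>x \<in> carrier A; y \<in> carrier A\<rbrakk> \<Longrightarrow> f (x \<oplus>\<^bsub>A\<^esub> y) = f x \<oplus>\<^bsub>B\<^esub> f y"
    "\<lbrakk>x \<in> carrier A; y \<in> carrier A\<rbrakk> \<Longrightarrow> f (x \<rightharpoonup>\<^bsub>A\<^esub> y) = f x \<rightharpoonup>\<^bsub>B\<^esub> f y"
  using assms by (auto simp: surj_hom_def)

lemma (in hoop) hoop_surj_hom:
  assumes f: "surj_hom P Q f" shows "hoop Q"
proof -
  have Q: "carrier Q = f ` carrier P" and zero: "\<zero>\<^bsub>Q\<^esub> = f \<zero>"
    using surj_homD[OF f] by simp_all
  have ops [simp]: "f x \<oplus>\<^bsub>Q\<^esub> f y = f (x \<oplus> y)" "f x \<rightharpoonup>\<^bsub>Q\<^esub> f y = f (x \<rightharpoonup> y)"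
    if "x \<in> carrier P" "y \<in> carrier P" for x y
    using surj_homD[OF f] that by simp_all
  show ?thesis
    by (rule hoopI; unfold Q zero)
      (auto simp: add_assoc add_imp intro!: arg_cong[of _ _ f] intro: add_commute divisibility)
qed

text \<open>Both claims share one induction because \<open>f\<close> is known to respect the
  operations only on the carrier.\<close>

lemma surj_hom_term_val:
  assumes f: "surj_hom A B f" and "pocrim A" and x: "x \<in> V \<rightarrow> carrier A"
    and "hoop_term_vars t \<subseteq> V"
  shows "hoop_term_val A x t \<in> carrier A \<and> f (hoop_term_val A x t) = hoop_term_val B (f \<circ> x) t"
proof -
  interpret pocrim A by fact
  show ?thesis using assms(4)
    by (induction t) (use x surj_homD[OF f] in auto)
qed

lemma hoop_generate_closed:
  assumes "pocrim A" "X \<subseteq> carrier A" shows "hoop_generate A X \<subseteq> carrier A"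
proof
  interpret pocrim A by fact
  show "y \<in> carrier A" if "y \<in> hoop_generate A X" for y
    using that by induction (use assms(2) in auto)
qed

section \<open>Ideals\<close>

context pocrim
begin

text \<open>Ideals serve as the kernels of homomorphisms. With the order reversed they are the
  filters of the literature.\<close>

definition ideal :: "'a set \<Rightarrow> bool" where
  "ideal I \<longleftrightarrow> I \<subseteq> carrier P \<and> \<zero> \<in> I \<and> (\<forall>x \<in> I. \<forall>y \<in> I. x \<oplus> y \<in> I) \<and>
    (\<forall>x \<in> I. \<forall>y \<in> carrier P. x \<succeq> y \<longrightarrow> y \<in> I)"

lemma ideal_downward: "\<lbrakk>ideal I; x \<in> I; x \<succeq> y; y \<in> carrier P\<rbrakk> \<Longrightarrow> y \<in> I"
  and ideal_add: "\<lbrakk>ideal I; x \<in> I; y \<in> I\<rbrakk> \<Longrightarrow> x \<oplus> y \<in> I"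
  and ideal_zero: "ideal I \<Longrightarrow> \<zero> \<in> I"
  and ideal_closed: "\<lbrakk>ideal I; x \<in> I\<rbrakk> \<Longrightarrow> x \<in> carrier P"
  by (auto simp: ideal_def)

text \<open>This is the ideal generated by \<open>I\<close> and \<open>x\<close>. Its explicit form
  is what turns maximality of an ideal into the archimedean property of the quotient.\<close>

lemma ideal_adjoin:
  assumes I: "ideal I" and x: "x \<in> carrier P"
  shows "ideal {y \<in> carrier P. \<exists>n. \<exists>i \<in> I. multiple n x \<oplus> i \<succeq> y}" (is "ideal ?J")
  unfolding ideal_def
proof (intro conjI ballI impI)
  note [simp] = ideal_closed[OF I]
  show "?J \<subseteq> carrier P" by auto
  show "\<zero> \<in> ?J" using I x ideal_zero geq_zero by auto
next
  fix y z assume "y \<in> ?J" "z \<in> ?J"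
  then obtain m n i j where *: "y \<in> carrier P" "z \<in> carrier P" "i \<in> I" "j \<in> I"
    "multiple m x \<oplus> i \<succeq> y" "multiple n x \<oplus> j \<succeq> z" by auto
  note [simp] = ideal_closed[OF I]
  have "(multiple m x \<oplus> i) \<oplus> (multiple n x \<oplus> j) \<succeq> y \<oplus> z"
    using * x by (intro add_mono2) auto
  also have "(multiple m x \<oplus> i) \<oplus> (multiple n x \<oplus> j) = multiple (m + n) x \<oplus> (i \<oplus> j)"
    using * x by (simp add: multiple_add add_ac)
  finally show "y \<oplus> z \<in> ?J" using * ideal_add[OF I] by blast
next
  fix y z assume *: "y \<in> ?J" "z \<in> carrier P" "y \<succeq> z"
  then obtain n i where n: "i \<in> I" "multiple n x \<oplus> i \<succeq> y" "y \<in> carrier P" by auto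
  then have "multiple n x \<oplus> i \<succeq> z"
    using * x ideal_closed[OF I] geq_trans[of "multiple n x \<oplus> i" y z] by simp
  then show "z \<in> ?J" using * n by blast
qed

text \<open>The last property expresses maximality: adjoining any further \<open>x\<close> must
  capture \<open>e\<close>. Modulo \<open>I\<close> it says that a multiple of \<open>x\<close> lies
  above \<open>e\<close>.\<close>

lemma ex_maximal_ideal:
  assumes e: "e \<in> carrier P" "e \<noteq> \<zero>"
  obtains I where "ideal I" "e \<notin> I"
    "\<And>x. \<lbrakk>x \<in> carrier P; x \<notin> I\<rbrakk> \<Longrightarrow> \<exists>n. \<exists>i \<in> I. multiple n x \<oplus> i \<succeq> e"
proof -
  let ?A = "{I. ideal I \<and> e \<notin> I}"
  have "\<exists>M \<in> ?A. \<forall>X \<in> ?A. M \<subseteq> X \<longrightarrow> X = M"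
  proof (rule subset_Zorn_nonempty)
    have "ideal {\<zero>}" using zero_geq by (auto simp: ideal_def)
    then show "?A \<noteq> {}" using e by blast
  next
    fix C assume C: "C \<noteq> {}" "subset.chain ?A C"
    then have sub: "C \<subseteq> ?A" by (simp add: subset.chain_def)
    have "x \<oplus> y \<in> \<Union> C" if xy: "x \<in> \<Union> C" "y \<in> \<Union> C" for x y
    proof -
      from xy obtain I J where IJ: "I \<in> C" "J \<in> C" "x \<in> I" "y \<in> J" by blast
      then have "I \<subseteq> J \<or> J \<subseteq> I" using C(2) by (simp add: subset_chain_def)
      then obtain K where "K \<in> C" "x \<in> K" "y \<in> K" using IJ by blast
      moreover from this have "ideal K" using sub by blast
      ultimately show ?thesis using ideal_add[of K x y] by blast
    qed
    moreover have "\<zero> \<in> \<Union> C" using C(1) sub ideal_zero by blast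
    moreover have "\<Union> C \<subseteq> carrier P" using sub ideal_closed by blast
    moreover have "y \<in> \<Union> C" if "x \<in> \<Union> C" "y \<in> carrier P" "x \<succeq> y" for x y
      using that sub ideal_downward by blast
    ultimately have "ideal (\<Union> C)" by (simp add: ideal_def)
    then show "\<Union> C \<in> ?A" using sub by blast
  qed
  then obtain M where M: "ideal M" "e \<notin> M" and max: "\<And>X. \<lbrakk>ideal X; e \<notin> X; M \<subseteq> X\<rbrakk> \<Longrightarrow> X = M"
    by blast
  have "\<exists>n. \<exists>i \<in> M. multiple n x \<oplus> i \<succeq> e" if x: "x \<in> carrier P" "x \<notin> M" for x
  proof (rule ccontr)
    let ?J = "{y \<in> carrier P. \<exists>n. \<exists>i \<in> M. multiple n x \<oplus> i \<succeq> y}"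
    assume "\<not> ?thesis"
    then have "e \<notin> ?J" by blast
    \<comment> \<open>Coefficient 0 shows that \<open>?J\<close> contains \<open>M\<close>.
      Coefficient 1, with zero as the element of \<open>M\<close>, will show that it contains
      \<open>x\<close>.\<close>
    moreover have "M \<subseteq> ?J"
    proof
      fix i assume i: "i \<in> M"
      then have "multiple 0 x \<oplus> i \<succeq> i" using M(1) ideal_closed by simp
      then show "i \<in> ?J" using i M(1) ideal_closed by blast
    qed
    ultimately have "?J = M" using max[OF ideal_adjoin] M(1) x(1) by blast
    moreover have "multiple (Suc 0) x \<oplus> \<zero> \<succeq> x" using x by simp
    then have "x \<in> ?J" using x M(1) ideal_zero by blast
    ultimately show False using x(2) by simp
  qed
  with M show thesis using that by blast
qed

section \<open>The congruence of an ideal and its quotient\<close>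

definition ideal_cong :: "'a set \<Rightarrow> 'a \<Rightarrow> 'a \<Rightarrow> bool" where
  "ideal_cong I x y \<longleftrightarrow> x \<rightharpoonup> y \<in> I \<and> y \<rightharpoonup> x \<in> I"

lemma ideal_cong_sym: "ideal_cong I x y \<Longrightarrow> ideal_cong I y x"
  by (simp add: ideal_cong_def)

lemma ideal_cong_refl: "\<lbrakk>ideal I; x \<in> carrier P\<rbrakk> \<Longrightarrow> ideal_cong I x x"
  by (simp add: ideal_cong_def ideal_zero)

lemma ideal_imp_trans:
  assumes "ideal I" "x \<rightharpoonup> y \<in> I" "y \<rightharpoonup> z \<in> I" "x \<in> carrier P" "y \<in> carrier P" "z \<in> carrier P"
  shows "x \<rightharpoonup> z \<in> I"
  using assms imp_triangle[of x y z] ideal_downward ideal_add by (meson imp_closed)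

lemma ideal_cong_trans:
  assumes "ideal I" "ideal_cong I x y" "ideal_cong I y z"
    "x \<in> carrier P" "y \<in> carrier P" "z \<in> carrier P"
  shows "ideal_cong I x z"
  using assms unfolding ideal_cong_def by (meson ideal_imp_trans)

lemma ideal_add_imp_add:
  assumes "ideal I" "x \<rightharpoonup> x' \<in> I" "x \<in> carrier P" "x' \<in> carrier P" "y \<in> carrier P"
  shows "(x \<oplus> y) \<rightharpoonup> (x' \<oplus> y) \<in> I"
proof -
  have "(x \<oplus> (x \<rightharpoonup> x')) \<oplus> y \<succeq> x' \<oplus> y"
    using assms by (intro add_mono modus_ponens) auto
  then have "(x \<rightharpoonup> x') \<oplus> (x \<oplus> y) \<succeq> x' \<oplus> y" using assms by (simp add: add_ac)
  then show ?thesis using assms ideal_downward[OF assms(1,2)] by (simp add: residuation)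
qed

lemma ideal_cong_add:
  assumes "ideal I" "ideal_cong I x x'" "ideal_cong I y y'"
    "x \<in> carrier P" "x' \<in> carrier P" "y \<in> carrier P" "y' \<in> carrier P"
  shows "ideal_cong I (x \<oplus> y) (x' \<oplus> y')"
proof (rule ideal_cong_trans)
  show "ideal_cong I (x \<oplus> y) (x' \<oplus> y)"
    using assms by (simp add: ideal_cong_def ideal_add_imp_add)
  show "ideal_cong I (x' \<oplus> y) (x' \<oplus> y')"
    using assms ideal_add_imp_add[of I y y' x'] ideal_add_imp_add[of I y' y x']
    by (simp add: ideal_cong_def add_commute)
qed (use assms in auto)

lemma ideal_cong_imp:
  assumes "ideal I" "ideal_cong I x x'" "ideal_cong I y y'"
    "x \<in> carrier P" "x' \<in> carrier P" "y \<in> carrier P" "y' \<in> carrier P"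
  shows "ideal_cong I (x \<rightharpoonup> y) (x' \<rightharpoonup> y')"
proof (rule ideal_cong_trans)
  \<comment> \<open>Both facts are \<open>imp_triangle\<close> read through residuation. The two
    arguments of the implication are then replaced one at a time.\<close>
  have *: "(a \<rightharpoonup> c) \<rightharpoonup> (b \<rightharpoonup> c) \<in> I"
    if "b \<rightharpoonup> a \<in> I" "a \<in> carrier P" "b \<in> carrier P" "c \<in> carrier P" for a b c
    using that imp_triangle[of b a c] ideal_downward[OF assms(1) that(1)]
    by (simp add: residuation)
  have **: "(c \<rightharpoonup> a) \<rightharpoonup> (c \<rightharpoonup> b) \<in> I"
    if "a \<rightharpoonup> b \<in> I" "a \<in> carrier P" "b \<in> carrier P" "c \<in> carrier P" for a b c
    using that imp_triangle[of c a b] ideal_downward[OF assms(1) that(1)]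
      residuation[of "a \<rightharpoonup> b" "c \<rightharpoonup> a" "c \<rightharpoonup> b"]
    by (simp add: add_commute)
  show "ideal_cong I (x \<rightharpoonup> y) (x' \<rightharpoonup> y)" "ideal_cong I (x' \<rightharpoonup> y) (x' \<rightharpoonup> y')"
    using assms * ** by (simp_all add: ideal_cong_def)
qed (use assms in auto)

text \<open>A quotient by classes would live on sets over \<open>'a\<close>. Instead, a choice of
  representatives is followed by an injection of the countable carrier through \<open>nat\<close>
  into \<open>'b\<close>.\<close>

lemma ex_ideal_cong_kernel:
  assumes I: "ideal I" and "countable (carrier P)" and "infinite (UNIV :: 'b set)"
  obtains f :: "'a \<Rightarrow> 'b"
    where "\<And>x y. \<lbrakk>x \<in> carrier P; y \<in> carrier P\<rbrakk> \<Longrightarrow> f x = f y \<longleftrightarrow> ideal_cong I x y"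
proof -
  obtain h :: "nat \<Rightarrow> 'b" where h: "inj h" using infinite_countable_subset[OF assms(3)] by blast
  let ?g = "h \<circ> to_nat_on (carrier P)"
  have g: "inj_on ?g (carrier P)"
    using assms(2) h by (intro comp_inj_on inj_on_to_nat_on) (auto intro: inj_on_subset)
  define c where "c x = (SOME y. y \<in> carrier P \<and> ideal_cong I x y)" for x
  have c: "c x \<in> carrier P" "ideal_cong I x (c x)" if "x \<in> carrier P" for x
    using someI[of "\<lambda>y. y \<in> carrier P \<and> ideal_cong I x y" x] ideal_cong_refl[OF I that] that
    by (auto simp: c_def)
  have "?g (c x) = ?g (c y) \<longleftrightarrow> ideal_cong I x y" if x: "x \<in> carrier P" and y: "y \<in> carrier P" for x y
  proof
    assume "?g (c x) = ?g (c y)"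
    then have "c x = c y" using inj_onD[OF g] c(1) x y by blast
    then show "ideal_cong I x y"
      using ideal_cong_trans[OF I c(2)[OF x] _ x c(1)[OF x] y] c(2)[OF y] ideal_cong_sym by metis
  next
    assume "ideal_cong I x y"
    \<comment> \<open>Congruent elements give equivalent predicates under \<open>SOME\<close>, so
      their chosen representatives are equal and not merely congruent.\<close>
    then have "ideal_cong I x z \<longleftrightarrow> ideal_cong I y z" if "z \<in> carrier P" for z
      using ideal_cong_trans[OF I] ideal_cong_sym x y that by blast
    then have "c x = c y" unfolding c_def by metis
    then show "?g (c x) = ?g (c y)" by simp
  qed
  then show thesis using that[of "?g \<circ> c"] by simp
qed

end

text \<open>The parameter \<open>m\<close> holds the additional record fields of the image, so that one definition
  serves hoops and bounded hoops.\<close>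

definition image_algebra ::
    "('a, 'm) pocrim_struct_scheme \<Rightarrow> ('a \<Rightarrow> 'b) \<Rightarrow> 'n \<Rightarrow> ('b, 'n) pocrim_struct_scheme"
  where "image_algebra A f m = \<lparr>carrier = f ` carrier A, zero = f \<zero>\<^bsub>A\<^esub>,
    add = (\<lambda>a b. f (inv_into (carrier A) f a \<oplus>\<^bsub>A\<^esub> inv_into (carrier A) f b)),
    imp = (\<lambda>a b. f (inv_into (carrier A) f a \<rightharpoonup>\<^bsub>A\<^esub> inv_into (carrier A) f b)), \<dots> = m\<rparr>"

lemma (in pocrim) surj_hom_image_algebra:
  assumes I: "ideal I"
    and f: "\<And>x y. \<lbrakk>x \<in> carrier P; y \<in> carrier P\<rbrakk> \<Longrightarrow> f x = f y \<longleftrightarrow> ideal_cong I x y"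
  shows "surj_hom P (image_algebra P f m) f"
proof -
  \<comment> \<open>The preimage that \<open>inv_into\<close> picks may differ from
    \<open>x\<close>, but it is congruent to \<open>x\<close>, which is all that well-definedness
    requires.\<close>
  have inv: "inv_into (carrier P) f (f x) \<in> carrier P"
      "ideal_cong I x (inv_into (carrier P) f (f x))" if "x \<in> carrier P" for x
    using that f_inv_into_f[of "f x" f "carrier P"] inv_into_into[of "f x" f "carrier P"] f
    by (metis imageI)+
  have "f (x \<oplus> y) = f (inv_into (carrier P) f (f x) \<oplus> inv_into (carrier P) f (f y))"
    "f (x \<rightharpoonup> y) = f (inv_into (carrier P) f (f x) \<rightharpoonup> inv_into (carrier P) f (f y))"
    if "x \<in> carrier P" "y \<in> carrier P" for x y
    using inv that I by (simp_all add: f ideal_cong_add ideal_cong_imp)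
  then show ?thesis by (simp add: surj_hom_def image_algebra_def)
qed

section \<open>Countermodels\<close>

instance hoop_term :: countable
  by countable_datatype

text \<open>Every generated element is the value of a term, and there are only countably many
  terms.\<close>

lemma countable_hoop_generate:
  fixes x :: "nat \<Rightarrow> 'a"
  shows "countable (hoop_generate H (x ` V))"
proof (rule countable_subset)
  show "hoop_generate H (x ` V) \<subseteq> range (hoop_term_val H x)"
  proof
    show "y \<in> range (hoop_term_val H x)" if "y \<in> hoop_generate H (x ` V)" for y
      using that
    proof induction
      case zero
      then show ?case by (rule range_eqI[of _ _ HZero]) simp
    next
      case (incl y)
      then obtain i where "y = x i" by blast
      then show ?case by (intro range_eqI[of _ _ "HVar i"]) simp
    next
      case (add y z)
      then obtain t u where "y = hoop_term_val H x t" "z = hoop_term_val H x u" by blast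
      then show ?case by (intro range_eqI[of _ _ "HAdd t u"]) simp
    next
      case (imp y z)
      then obtain t u where "y = hoop_term_val H x t" "z = hoop_term_val H x u" by blast
      then show ?case by (intro range_eqI[of _ _ "HImp t u"]) simp
    qed
  qed
qed simp

lemma hoop_term_val_subalgebra [simp]:
  "hoop_term_val (subalgebra H A) x t = hoop_term_val H x t"
  by (induction t) auto

lemma surj_hom_hoop_generate:
  assumes K: "surj_hom (subalgebra H (hoop_generate H X)) K f" and "pocrim K"
  shows "hoop_generate K (f ` X) = carrier K"
proof
  note hom = surj_homD[OF K, simplified]
  show "hoop_generate K (f ` X) \<subseteq> carrier K"
    using hom(1) \<open>pocrim K\<close> by (intro hoop_generate_closed) (auto intro: hoop_generate.incl)
  have "f y \<in> hoop_generate K (f ` X)" if "y \<in> hoop_generate H X" for y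
    using that
    by induction (auto simp: hom intro: hoop_generate.intros)
  then show "carrier K \<subseteq> hoop_generate K (f ` X)" by (auto simp: hom(1)[symmetric])
qed

text \<open>Since \<open>f\<close> sends exactly \<open>I\<close> to zero, the summand from
  \<open>I\<close> in \<open>max\<close> disappears in the image, and the archimedean property for
  \<open>f e\<close> remains.\<close>

lemma si_hoop_surj_hom:
  assumes "hoop G" and f: "surj_hom G K f" and e: "e \<in> carrier G" and I: "pocrim.ideal G I" "e \<notin> I"
    and kernel: "\<And>x y. \<lbrakk>x \<in> carrier G; y \<in> carrier G\<rbrakk> \<Longrightarrow> f x = f y \<longleftrightarrow> pocrim.ideal_cong G I x y"
    and max: "\<And>x. \<lbrakk>x \<in> carrier G; x \<notin> I\<rbrakk> \<Longrightarrow> \<exists>n. \<exists>i \<in> I. pocrim.multiple G n x \<oplus>\<^bsub>G\<^esub> i \<succeq>\<^bsub>G\<^esub> e"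
  shows "si_hoop K (f e)"
proof -
  interpret G: hoop G by fact
  interpret K: hoop K using G.hoop_surj_hom[OF f] .
  note hom = surj_homD[OF f]
  have f_zero: "f x = \<zero>\<^bsub>K\<^esub> \<longleftrightarrow> x \<in> I" if "x \<in> carrier G" for x
    using kernel[OF that G.zero_closed] that I G.ideal_zero by (simp add: G.ideal_cong_def hom)
  have f_multiple: "f (G.multiple n x) = K.multiple n (f x)" if "x \<in> carrier G" for n x
    by (induction n) (use that in \<open>simp_all add: hom\<close>)
  show ?thesis
  proof
    show "f e \<in> carrier K" using e hom(1) by blast
    show "f e \<noteq> \<zero>\<^bsub>K\<^esub>" using f_zero e I by simp
    fix y assume y: "y \<in> carrier K" "y \<noteq> \<zero>\<^bsub>K\<^esub>"
    then obtain x where x: "x \<in> carrier G" "y = f x" using hom(1) by blast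
    then obtain n i where i: "i \<in> I" "G.multiple n x \<oplus>\<^bsub>G\<^esub> i \<succeq>\<^bsub>G\<^esub> e" using max f_zero y by blast
    then have [simp]: "i \<in> carrier G" using I G.ideal_closed by blast
    have [simp]: "f z \<in> carrier K" if "z \<in> carrier G" for z using that hom(1) by blast
    have "f ((G.multiple n x \<oplus>\<^bsub>G\<^esub> i) \<rightharpoonup>\<^bsub>G\<^esub> e) = \<zero>\<^bsub>K\<^esub>" using i hom(2) by (simp add: geq_def)
    then have "K.multiple n y \<rightharpoonup>\<^bsub>K\<^esub> f e = \<zero>\<^bsub>K\<^esub>"
      using x e i f_zero[of i] by (simp add: hom f_multiple)
    then show "\<exists>n. K.multiple n y \<succeq>\<^bsub>K\<^esub> f e" by (auto simp: geq_def)
  qed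
qed

text \<open>The final equivalence holds with both sides false, because \<open>u\<close> is a nonzero
  element of \<open>Low\<close>.\<close>

lemma (in si_hoop) ex_ordinal_sum:
  "\<exists>S F. is_ordinal_sum P S F \<and> subdirectly_irreducible S \<and> wajsberg_hoop S \<and>
    (carrier S = {\<zero>\<^bsub>S\<^esub>} \<longleftrightarrow> carrier P = {\<zero>})"
proof -
  have "Low \<noteq> {\<zero>}" "carrier P \<noteq> {\<zero>}" using u_in_Low u_nonzero u_closed by blast+
  then show ?thesis
    using is_ordinal_sum_Low_Fix subdirectly_irreducible_Low wajsberg_Low
    by (intro exI[of _ "subalgebra P Low"] exI[of _ "subalgebra P Fix"]) simp
qed

text \<open>The extra fields \<open>m\<close> are a function of \<open>f\<close> because the top
  element of the image has to be the image of the top element, and \<open>f\<close> is found only in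
  the course of the proof.\<close>

lemma ordinal_sum_countermodel:
  fixes H :: "('a, 'm) pocrim_struct_scheme" and V :: "nat set" and m :: "('a \<Rightarrow> 'b) \<Rightarrow> 'n"
  defines "G x \<equiv> subalgebra H (hoop_generate H (x ` V))"
  assumes "hoop H" and x: "x \<in> V \<rightarrow> carrier H"
    and vars: "hoop_term_vars s \<subseteq> V" "hoop_term_vars t \<subseteq> V"
    and neq: "hoop_term_val H x s \<noteq> hoop_term_val H x t"
    and inf: "infinite (UNIV :: 'b set)"
  obtains f and K :: "('b, 'n) pocrim_struct_scheme"
    where "surj_hom (G x) K f" "pocrim_struct.more K = m f" "hoop K"
      "f \<circ> x \<in> V \<rightarrow> carrier K" "hoop_generate K ((f \<circ> x) ` V) = carrier K"
      "\<exists>S F. is_ordinal_sum K S F \<and> subdirectly_irreducible S \<and> wajsberg_hoop S \<and>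
        (carrier S = {zero S} \<longleftrightarrow> carrier K = {zero K})"
      "hoop_term_val K (f \<circ> x) s \<noteq> hoop_term_val K (f \<circ> x) t"
proof -
  interpret H: hoop H by fact
  have sub: "hoop_generate H (x ` V) \<subseteq> carrier H"
    using x by (intro hoop_generate_closed H.pocrim_axioms) auto
  interpret G: hoop "G x"
    unfolding G_def using sub by (intro H.hoop_subalgebra) (auto intro: hoop_generate.intros)
  have xG: "x \<in> V \<rightarrow> carrier (G x)" by (auto simp: G_def intro: hoop_generate.incl)
  define a b where "a = hoop_term_val (G x) x s" and "b = hoop_term_val (G x) x t"
  \<comment> \<open>The identity makes \<open>surj_hom_term_val\<close> yield that term values stay
    in the generated subhoop.\<close>
  have hom_id: "surj_hom (G x) (G x) id" by (simp add: surj_hom_def)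
  have ab: "a \<in> carrier (G x)" "b \<in> carrier (G x)"
    using surj_hom_term_val[OF hom_id G.pocrim_axioms xG] vars by (auto simp: a_def b_def)
  have "a \<noteq> b" using neq by (simp add: a_def b_def G_def)
  \<comment> \<open>By antisymmetry at least one of the two differences is nonzero. An ideal that
    omits it keeps the values of \<open>s\<close> and \<open>t\<close> apart in the
    quotient.\<close>
  then obtain e where e: "e \<in> carrier (G x)" "e \<noteq> \<zero>\<^bsub>G x\<^esub>"
      "e = a \<rightharpoonup>\<^bsub>G x\<^esub> b \<or> e = b \<rightharpoonup>\<^bsub>G x\<^esub> a"
    using ab G.geq_antisym[of a b] by (auto simp: geq_def)
  obtain I where I: "G.ideal I" "e \<notin> I"
    and max: "\<And>x'. \<lbrakk>x' \<in> carrier (G x); x' \<notin> I\<rbrakk> \<Longrightarrow> \<exists>n. \<exists>i \<in> I. G.multiple n x' \<oplus>\<^bsub>G x\<^esub> i \<succeq>\<^bsub>G x\<^esub> e"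
    using G.ex_maximal_ideal[OF e(1,2)] by blast
  have "countable (carrier (G x))" by (simp add: G_def countable_hoop_generate)
  then obtain f :: "'a \<Rightarrow> 'b" where
    f: "\<And>y z. \<lbrakk>y \<in> carrier (G x); z \<in> carrier (G x)\<rbrakk> \<Longrightarrow> f y = f z \<longleftrightarrow> G.ideal_cong I y z"
    using G.ex_ideal_cong_kernel[OF I(1) _ inf] by blast
  define K where "K = image_algebra (G x) f (m f)"
  have K: "surj_hom (G x) K f"
    unfolding K_def using G.surj_hom_image_algebra[OF I(1) f] .
  interpret K: si_hoop K "f e"
    using si_hoop_surj_hom[OF G.hoop_axioms K e(1) I f max] .
  show thesis
  proof (rule that[OF K _ K.hoop_axioms _ _ K.ex_ordinal_sum])
    show "pocrim_struct.more K = m f" by (simp add: K_def image_algebra_def)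
    have "f a \<noteq> f b" using f[OF ab] e(3) I(2) by (auto simp: G.ideal_cong_def)
    then show "hoop_term_val K (f \<circ> x) s \<noteq> hoop_term_val K (f \<circ> x) t"
      using surj_hom_term_val[OF K G.pocrim_axioms xG] vars by (simp add: a_def b_def)
    show "f \<circ> x \<in> V \<rightarrow> carrier K" unfolding surj_homD(1)[OF K, symmetric] using xG by auto
    show "hoop_generate K ((f \<circ> x) ` V) = carrier K"
      using surj_hom_hoop_generate[OF K[unfolded G_def] K.pocrim_axioms] by (simp add: image_comp)
  qed
qed

lemma hoop_countermodel:
  fixes H :: "('a, 'm) pocrim_struct_scheme"
  assumes "hoop H" "x \<in> V \<rightarrow> carrier H" "hoop_term_vars s \<union> hoop_term_vars t \<subseteq> V"
    "hoop_term_val H x s \<noteq> hoop_term_val H x t" "infinite (UNIV :: 'b set)"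
  obtains K :: "'b pocrim_struct" and y where "hoop K" "y \<in> V \<rightarrow> carrier K"
    "\<exists>S F. is_ordinal_sum K S F \<and> subdirectly_irreducible S \<and> wajsberg_hoop S \<and>
       hoop_generate K (y ` V) = carrier K \<and> (carrier S = {zero S} \<longleftrightarrow> carrier K = {zero K})"
    "hoop_term_val K y s \<noteq> hoop_term_val K y t"
proof -
  have vars: "hoop_term_vars s \<subseteq> V" "hoop_term_vars t \<subseteq> V" using assms(3) by auto
  obtain f and K :: "'b pocrim_struct"
    where "surj_hom (subalgebra H (hoop_generate H (x ` V))) K f" "pocrim_struct.more K = ()"
      and K: "hoop K" "f \<circ> x \<in> V \<rightarrow> carrier K" "hoop_generate K ((f \<circ> x) ` V) = carrier K"
        "\<exists>S F. is_ordinal_sum K S F \<and> subdirectly_irreducible S \<and> wajsberg_hoop S \<and>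
          (carrier S = {zero S} \<longleftrightarrow> carrier K = {zero K})"
        "hoop_term_val K (f \<circ> x) s \<noteq> hoop_term_val K (f \<circ> x) t"
    by (rule ordinal_sum_countermodel[OF assms(1,2) vars assms(4,5), where m = "\<lambda>_. ()"])
  show thesis
    by (rule that[OF K(1,2) _ K(5)]) (simp only: K(3,4) simp_thms)
qed

text \<open>As the identities only use the variables \<open>x\<^sub>1, \<dots>, x\<^sub>n\<close>, the variable \<open>x\<^sub>0\<close> is free to stand for
  the constant \<open>1\<close>.\<close>

primrec to_hoop_term :: "bounded_hoop_term \<Rightarrow> hoop_term" where
  "to_hoop_term (BVar i) = HVar i"
| "to_hoop_term BZero = HZero"
| "to_hoop_term BOne = HVar 0"
| "to_hoop_term (BAdd s t) = HAdd (to_hoop_term s) (to_hoop_term t)"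
| "to_hoop_term (BImp s t) = HImp (to_hoop_term s) (to_hoop_term t)"

lemma hoop_term_vars_to_hoop_term: "hoop_term_vars (to_hoop_term t) \<subseteq> insert 0 (bounded_hoop_term_vars t)"
  by (induction t) auto

lemma hoop_term_val_to_hoop_term:
  "0 \<notin> bounded_hoop_term_vars t \<Longrightarrow>
    hoop_term_val H (x(0 := top_elem H)) (to_hoop_term t) = bounded_hoop_term_val H x t"
  by (induction t) auto

lemma hoop_generate_insert_top:
  "hoop_generate H (insert (top_elem H) X) = bounded_hoop_generate H X" (is "?A = ?B")
proof
  show "?A \<subseteq> ?B"
  proof
    show "y \<in> ?B" if "y \<in> ?A" for y
      using that by induction (auto intro: bounded_hoop_generate.intros)
  qed
  show "?B \<subseteq> ?A"
  proof
    show "y \<in> ?A" if "y \<in> ?B" for y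
      using that by induction (auto intro: hoop_generate.intros)
  qed
qed

text \<open>With the top element as value of variable 0, the construction for hoops applies to the
  variables \<open>insert 0 V\<close>. The image is bounded because the surjective homomorphism
  preserves absorption by the top. As the top is among the generators, generation as a hoop from
  \<open>insert 0 V\<close> becomes generation as a bounded hoop from \<open>V\<close>.\<close>

lemma bounded_hoop_countermodel:
  fixes H :: "('a, 'm) bounded_pocrim_struct_scheme"
  assumes "bounded_hoop H" and x: "x \<in> V \<rightarrow> carrier H" and V: "0 \<notin> V"
    and vars: "bounded_hoop_term_vars s \<union> bounded_hoop_term_vars t \<subseteq> V"
    and neq: "bounded_hoop_term_val H x s \<noteq> bounded_hoop_term_val H x t"
    and inf: "infinite (UNIV :: 'b set)"
  obtains K :: "'b bounded_pocrim_struct" and y where "bounded_hoop K" "y \<in> V \<rightarrow> carrier K"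
    "\<exists>S F. is_ordinal_sum K S F \<and> subdirectly_irreducible S \<and> wajsberg_hoop S \<and>
       bounded_hoop_generate K (y ` V) = carrier K \<and>
       (carrier S = {zero S} \<longleftrightarrow> carrier K = {zero K})"
    "bounded_hoop_term_val K y s \<noteq> bounded_hoop_term_val K y t"
proof -
  interpret H: bounded_hoop H by fact
  let ?V = "insert 0 V" and ?x = "x(0 := top_elem H)"
  let ?G = "subalgebra H (hoop_generate H (?x ` ?V))"
  have 0: "0 \<notin> bounded_hoop_term_vars s" "0 \<notin> bounded_hoop_term_vars t" using V vars by auto
  have x': "?x \<in> ?V \<rightarrow> carrier H" using x H.top_closed by auto
  have vars': "hoop_term_vars (to_hoop_term s) \<subseteq> ?V" "hoop_term_vars (to_hoop_term t) \<subseteq> ?V"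
    using hoop_term_vars_to_hoop_term vars by blast+
  have neq': "hoop_term_val H ?x (to_hoop_term s) \<noteq> hoop_term_val H ?x (to_hoop_term t)"
    using neq 0 by (simp add: hoop_term_val_to_hoop_term)
  obtain f and K :: "'b bounded_pocrim_struct"
    where hom: "surj_hom ?G K f"
    and more: "pocrim_struct.more K = bounded_pocrim_struct.fields (f (top_elem H))"
    and K: "hoop K" "f \<circ> ?x \<in> ?V \<rightarrow> carrier K"
      "hoop_generate K ((f \<circ> ?x) ` ?V) = carrier K"
      "\<exists>S F. is_ordinal_sum K S F \<and> subdirectly_irreducible S \<and> wajsberg_hoop S \<and>
        (carrier S = {zero S} \<longleftrightarrow> carrier K = {zero K})"
      "hoop_term_val K (f \<circ> ?x) (to_hoop_term s) \<noteq> hoop_term_val K (f \<circ> ?x) (to_hoop_term t)"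
    by (rule ordinal_sum_countermodel[OF H.hoop_axioms x' vars' neq' inf,
          where m = "\<lambda>f. bounded_pocrim_struct.fields (f (top_elem H))"])
  have top: "top_elem K = f (top_elem H)"
    using more by (cases K) (simp add: bounded_pocrim_struct.defs)
  \<comment> \<open>The new assignment again gives variable 0 the top element as value, so the
    translation of terms can be undone in \<open>K\<close>.\<close>
  have y: "f \<circ> ?x = (f \<circ> x)(0 := top_elem K)" by (auto simp: top)
  note fK = K[unfolded y]
  have "top_elem H \<in> carrier ?G" by (auto intro: hoop_generate.incl)
  moreover have "carrier ?G \<subseteq> carrier H"
    using hoop_generate_closed[OF H.pocrim_axioms funcset_image[OF x']] by simp
  ultimately have "z \<oplus>\<^bsub>K\<^esub> top_elem K = top_elem K" if "z \<in> carrier K" for z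
    using that surj_homD[OF hom] H.add_top unfolding top
    by (smt (verit) imageE subalgebra_simps(3) subsetD)
  moreover have "top_elem K \<in> carrier K" using fK by auto
  ultimately have "bounded_hoop K"
    using fK by (simp add: bounded_hoop_def bounded_hoop_axioms_def)
  moreover have "f \<circ> x \<in> V \<rightarrow> carrier K"
    using fK V by (auto simp: Pi_iff split: if_splits)
  moreover have "((f \<circ> x)(0 := top_elem K)) ` ?V = insert (top_elem K) ((f \<circ> x) ` V)"
    using V by (simp del: fun_upd_apply add: fun_upd_image[of _ _ _ V] image_insert) simp
  then have "bounded_hoop_generate K ((f \<circ> x) ` V) = carrier K"
    using fK by (simp add: hoop_generate_insert_top)
  moreover have "bounded_hoop_term_val K (f \<circ> x) s \<noteq> bounded_hoop_term_val K (f \<circ> x) t"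
    using fK 0 by (simp add: hoop_term_val_to_hoop_term)
  ultimately show thesis
    by (intro that[of K "f \<circ> x"]) (use K(4) in \<open>simp_all only: simp_thms\<close>)
qed

theorem theorem4p2p1:
  assumes "infinite (UNIV :: 'a set)" and "infinite (UNIV :: 'b set)"
  shows
    "(\<forall>(n::nat) s t. hoop_term_vars s \<union> hoop_term_vars t \<subseteq> {1..n} \<longrightarrow>
       ((\<forall>H :: 'a pocrim_struct. hoop H \<longrightarrow>
           (\<forall>x \<in> {1..n} \<rightarrow> carrier H. hoop_term_val H x s = hoop_term_val H x t))
        \<longleftrightarrow>
        (\<forall>H :: 'b pocrim_struct. hoop H \<longrightarrow>
           (\<forall>x \<in> {1..n} \<rightarrow> carrier H.
              (\<exists>S F. is_ordinal_sum H S F \<and> subdirectly_irreducible S \<and> wajsberg_hoop S \<and>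
                 hoop_generate H (x ` {1..n}) = carrier H \<and>
                 (carrier S = {zero S} \<longleftrightarrow> carrier H = {zero H})) \<longrightarrow>
              hoop_term_val H x s = hoop_term_val H x t))))
   \<and>
     (\<forall>(n::nat) s t. bounded_hoop_term_vars s \<union> bounded_hoop_term_vars t \<subseteq> {1..n} \<longrightarrow>
       ((\<forall>H :: 'a bounded_pocrim_struct. bounded_hoop H \<longrightarrow>
           (\<forall>x \<in> {1..n} \<rightarrow> carrier H. bounded_hoop_term_val H x s = bounded_hoop_term_val H x t))
        \<longleftrightarrow>
        (\<forall>H :: 'b bounded_pocrim_struct. bounded_hoop H \<longrightarrow>
           (\<forall>x \<in> {1..n} \<rightarrow> carrier H.
              (\<exists>S F. is_ordinal_sum H S F \<and> subdirectly_irreducible S \<and> wajsberg_hoop S \<and>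
                 bounded_hoop_generate H (x ` {1..n}) = carrier H \<and>
                 (carrier S = {zero S} \<longleftrightarrow> carrier H = {zero H})) \<longrightarrow>
              bounded_hoop_term_val H x s = bounded_hoop_term_val H x t))))"
proof (intro conjI allI impI iffI ballI)
  \<comment> \<open>A failure over \<open>'b\<close> yields a hoop over \<open>'a\<close> in which
    the identity fails, against its validity there.\<close>
  fix n :: nat and s t and H :: "'b pocrim_struct" and x
  assume "hoop_term_vars s \<union> hoop_term_vars t \<subseteq> {1..n}" "hoop H" "x \<in> {1..n} \<rightarrow> carrier H"
    "\<forall>H :: 'a pocrim_struct. hoop H \<longrightarrow>
      (\<forall>x \<in> {1..n} \<rightarrow> carrier H. hoop_term_val H x s = hoop_term_val H x t)"
  then show "hoop_term_val H x s = hoop_term_val H x t"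
    using hoop_countermodel[of H x "{1..n}" s t, OF _ _ _ _ assms(1)] by metis
next
  fix n :: nat and s t and H :: "'a pocrim_struct" and x
  assume "hoop_term_vars s \<union> hoop_term_vars t \<subseteq> {1..n}" "hoop H" "x \<in> {1..n} \<rightarrow> carrier H"
    "\<forall>H :: 'b pocrim_struct. hoop H \<longrightarrow>
      (\<forall>x \<in> {1..n} \<rightarrow> carrier H.
        (\<exists>S F. is_ordinal_sum H S F \<and> subdirectly_irreducible S \<and> wajsberg_hoop S \<and>
          hoop_generate H (x ` {1..n}) = carrier H \<and>
          (carrier S = {zero S} \<longleftrightarrow> carrier H = {zero H})) \<longrightarrow>
        hoop_term_val H x s = hoop_term_val H x t)"
  then show "hoop_term_val H x s = hoop_term_val H x t"
    using hoop_countermodel[of H x "{1..n}" s t, OF _ _ _ _ assms(2)] by metis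
next
  fix n :: nat and s t and H :: "'b bounded_pocrim_struct" and x
  assume "bounded_hoop_term_vars s \<union> bounded_hoop_term_vars t \<subseteq> {1..n}" "bounded_hoop H"
    "x \<in> {1..n} \<rightarrow> carrier H"
    "\<forall>H :: 'a bounded_pocrim_struct. bounded_hoop H \<longrightarrow>
      (\<forall>x \<in> {1..n} \<rightarrow> carrier H. bounded_hoop_term_val H x s = bounded_hoop_term_val H x t)"
  moreover have "0 \<notin> {1..n}" by simp
  ultimately show "bounded_hoop_term_val H x s = bounded_hoop_term_val H x t"
    using bounded_hoop_countermodel[of H x "{1..n}" s t, OF _ _ _ _ _ assms(1)] by metis
next
  fix n :: nat and s t and H :: "'a bounded_pocrim_struct" and x
  assume "bounded_hoop_term_vars s \<union> bounded_hoop_term_vars t \<subseteq> {1..n}" "bounded_hoop H"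
    "x \<in> {1..n} \<rightarrow> carrier H"
    "\<forall>H :: 'b bounded_pocrim_struct. bounded_hoop H \<longrightarrow>
      (\<forall>x \<in> {1..n} \<rightarrow> carrier H.
        (\<exists>S F. is_ordinal_sum H S F \<and> subdirectly_irreducible S \<and> wajsberg_hoop S \<and>
          bounded_hoop_generate H (x ` {1..n}) = carrier H \<and>
          (carrier S = {zero S} \<longleftrightarrow> carrier H = {zero H})) \<longrightarrow>
        bounded_hoop_term_val H x s = bounded_hoop_term_val H x t)"
  moreover have "0 \<notin> {1..n}" by simp
  ultimately show "bounded_hoop_term_val H x s = bounded_hoop_term_val H x t"
    using bounded_hoop_countermodel[of H x "{1..n}" s t, OF _ _ _ _ _ assms(2)] by metis
qed

end
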